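(* Let $(U_i,V_i)$, $i=1,2$, be independent bivariate normal random vectors with zero mean vector, variances $(\sigma_{U_i}^2,\sigma_{V_i}^2)$ with $\sigma_{U_i},\sigma_{V_i}>0$, and correlation coefficients $\rho_i\in(-1,1)$. Set $s_i=\sigma_{U_i}\sigma_{V_i}$, $W_i=U_iV_i$, $i=1,2$, and let $T=W_1/W_2$. Then the probability density function $f_T$ of $T$ is given, for $t\in\mathbb{R}\setminus\{0\}$, by \begin{align*} f_T(t)&=\frac{(s_1/s_2)(1-\rho_1^2)^{3/2}t^{-2}}{\pi^2\sqrt{1-\rho_2^2}}\sum_{i,j=0}^\infty\frac{a_{ij}\,\big(((i+j)/2)!\big)^4}{i!\,j!\,(i+j+1)!}(2\rho_1)^i\bigg(\frac{1-\rho_1^2}{1-\rho_2^2}\bigg)^j\bigg(\frac{2s_1\rho_2}{s_2t}\bigg)^j\\ &\quad\times{}_2F_1\bigg(1+\frac{i+j}{2},1+\frac{i+j}{2};2+i+j;1-\bigg(\frac{s_1(1-\rho_1^2)}{s_2(1-\rho_2^2)t}\bigg)^2\bigg). \end{align*} When $\rho_1=\rho_2=0$ this simplifies as follows: for $t\in\mathbb{R}\setminus\{0\}$, $$f_T(t)=\frac{2s_2}{\pi^2s_1}\,\frac{\log|s_2t/s_1|}{(s_2t/s_1)^2-1},$$ where at $|t|=s_1/s_2$ the right-hand side is understood as its limiting value.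
   Context: For integers $i,j\ge0$, $a_{ij}=(1+(-1)^{i+j})/2$, so $a_{ij}=1$ if $i+j$ is even and $a_{ij}=0$ if $i+j$ is odd. Throughout $x!=\Gamma(x+1)$ and $0^0=1$. ${}_2F_1(a,b;c;x)=\sum_{k=0}^\infty\frac{(a)_k(b)_k}{(c)_k}\frac{x^k}{k!}$ for $|x|<1$, with $(u)_k=u(u+1)\cdots(u+k-1)$, extended by analytic continuation (to $\mathbb{C}\setminus[1,\infty)$). Density formulas are for the version $f_T(t)=\int_{-\infty}^\infty|w|f_{W_1}(wt)f_{W_2}(w)\,\mathrm{d}w$, where for $w\neq0$ the density of $W_i$ is $$f_{W_i}(w)=\frac{1}{\pi s_i\sqrt{1-\rho_i^2}}\exp\Big(\frac{\rho_iw}{s_i(1-\rho_i^2)}\Big)K_0\Big(\frac{|w|}{s_i(1-\rho_i^2)}\Big),\qquad K_0(x)=\int_0^\infty\mathrm{e}^{-x\cosh t}\,\mathrm{d}t.$$ *)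

theory Defs
  imports "HOL-Probability.Probability"
begin

definition bivariate_normal_density ::
    "real \<Rightarrow> real \<Rightarrow> real \<Rightarrow> real \<Rightarrow> real \<Rightarrow> real \<times> real \<Rightarrow> real" where
  "bivariate_normal_density \<mu>u \<mu>v \<sigma>u \<sigma>v \<rho> = (\<lambda>(u, v).
     1 / (2 * pi * \<sigma>u * \<sigma>v * sqrt (1 - \<rho>\<^sup>2)) *
     exp (- (((u - \<mu>u) / \<sigma>u)\<^sup>2 - 2 * \<rho> * ((u - \<mu>u) / \<sigma>u) * ((v - \<mu>v) / \<sigma>v) + ((v - \<mu>v) / \<sigma>v)\<^sup>2)
          / (2 * (1 - \<rho>\<^sup>2))))"

(* Modified Bessel function of the second kind of order 0, for x > 0.  At x = 0 the integral
   diverges and the value here is 0 by the convention for non-integrable functions. *)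
definition bessel_K0 :: "real \<Rightarrow> real" where
  "bessel_K0 x = (LBINT t:{0..}. exp (- x * cosh t))"

(* Density of the product U * V of zero-mean normals with correlation \<rho>, s = \<sigma>u * \<sigma>v.
   Only the values at w \<noteq> 0 are meaningful. *)
definition normal_product_density :: "real \<Rightarrow> real \<Rightarrow> real \<Rightarrow> real" where
  "normal_product_density s \<rho> w =
     1 / (pi * s * sqrt (1 - \<rho>\<^sup>2)) * exp (\<rho> * w / (s * (1 - \<rho>\<^sup>2))) *
     bessel_K0 (\<bar>w\<bar> / (s * (1 - \<rho>\<^sup>2)))"

(* The version of the density of W1 / W2 obtained from densities f of W1 and g of W2. *)
definition ratio_density :: "(real \<Rightarrow> real) \<Rightarrow> (real \<Rightarrow> real) \<Rightarrow> real \<Rightarrow> real" where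
  "ratio_density f g t = (LBINT w. \<bar>w\<bar> * f (w * t) * g w)"

(* Gauss hypergeometric function: the analytic continuation of the series from the unit disc to
   the complex plane cut along [1, \<infinity>).  The continuation is unique there by the identity
   theorem, so the choice operator does not affect the value at any point off the cut. *)
definition hypergeo_2F1 :: "complex \<Rightarrow> complex \<Rightarrow> complex \<Rightarrow> complex \<Rightarrow> complex" where
  "hypergeo_2F1 a b c = (SOME F.
     F holomorphic_on (- complex_of_real ` {1..}) \<and>
     (\<forall>z. norm z < 1 \<longrightarrow>
        (\<lambda>k. pochhammer a k * pochhammer b k / pochhammer c k * (z ^ k / fact k)) sums F z))"

definition even_ind :: "nat \<Rightarrow> nat \<Rightarrow> real" where
  "even_ind i j = (1 + (-1) ^ (i + j)) / 2"

end

theory Submission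
  imports Defs "HOL-Complex_Analysis.Complex_Analysis"
begin

text \<open>
  On the half-line, substituting \<open>w = exp \<tau>\<close> and writing each factor as
  \<open>2 K\<^sub>0(a w) = \<integral> exp (- a\<^sup>2 e\<^sup>t - w\<^sup>2 e\<^sup>-\<^sup>t / 4) dt\<close> turns the moment
  \<open>\<integral> w\<^sup>2\<^sup>m\<^sup>+\<^sup>1 K\<^sub>0(a w) K\<^sub>0(b w) dw\<close> into two nested Gamma integrals and a remaining integral over
  \<open>r\<close>. The logistic substitution \<open>u = 1 / (1 + e\<^sup>-\<^sup>r)\<close> makes it the Euler integral
  \<open>\<integral> (u (1 - u))\<^sup>m / (a\<^sup>2 (1 - u) + b\<^sup>2 u)\<^sup>m\<^sup>+\<^sup>1 du\<close> over the unit interval, which is a hypergeometric value.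
  Expanding the two exponential factors of the density of the ratio and integrating term by
  term gives the double series: odd moments vanish by symmetry, and the bound
  \<open>K\<^sub>0(x) \<le> \<surd>(\<pi> / (2 x)) e\<^sup>-\<^sup>x\<close> with \<open>\<bar>\<rho>\<^sub>i\<bar> < 1\<close> dominates the sum.
\<close>

subsection \<open>Substitution on the real line\<close>

text \<open>The moments are computed as nonnegative integrals, so that each change of order is
  Tonelli and asks only for measurability; finiteness is read off from the final value. Logarithmic
  variables are used because they turn rescalings into translations. The second Bessel factor is
  shifted by the variable \<open>t\<close> of the first: the exponent of the product is then, up to
  sign, \<open>(a\<^sup>2 + b\<^sup>2 * exp r) * exp t\<close> plus \<open>w\<^sup>2\<close> times
  \<open>exp (- t) * (1 + exp (- r)) / 4\<close>, and the two Gamma integrals can be done one after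
  the other.

  The hypergeometric argument \<open>1 - (b / a)\<^sup>2\<close> is unbounded below as
  \<open>b / a\<close> varies, so the power series alone cannot give the value. The Euler integral
  is therefore shown to be holomorphic on the whole slit plane and is matched with the continuation
  by the identity theorem.

  In the double series, \<open>a\<close> and \<open>b\<close> are the decay rates of the two Bessel
  factors in \<open>w\<close>, and the exponential factors grow at rates
  \<open>\<bar>\<rho>1\<bar> * a\<close> and \<open>\<bar>\<rho>2\<bar> * b\<close> at most; this
  gap is what makes the dominating function integrable.\<close>

lemma nn_integral_substitution_range:
  fixes f g g' :: "real \<Rightarrow> real"
  assumes [measurable]: "f \<in> borel_measurable borel"
    and deriv: "\<And>x. (g has_real_derivative g' x) (at x)"
    and cont: "continuous_on UNIV g'"
    and nonneg: "\<And>x. g' x \<ge> 0"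
  shows "(\<integral>\<^sup>+x. ennreal (f x) * indicator (range g) x \<partial>lborel) = (\<integral>\<^sup>+x. ennreal (f (g x) * g' x) \<partial>lborel)"
proof (rule LIMSEQ_unique)
  have mono: "g x \<le> g y" if "x \<le> y" for x y
    using that deriv nonneg by (meson DERIV_nonneg_imp_nondecreasing)
  have contg: "continuous_on UNIV g"
    using deriv by (meson DERIV_isCont continuous_at_imp_continuous_on)
  have [measurable]: "g \<in> borel_measurable borel" "g' \<in> borel_measurable borel"
    using contg cont by (auto intro: borel_measurable_continuous_onI)
  have R: "range g = (\<Union>n::nat. {g (- real n)..g (real n)})"
  proof safe
    fix x :: real
    obtain n :: nat where "\<bar>x\<bar> \<le> real n" using real_arch_simple by blast
    then show "g x \<in> (\<Union>n::nat. {g (- real n)..g (real n)})"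
      by (intro UN_I[of n]) (auto intro!: mono)
  next
    fix y and n :: nat
    assume "y \<in> {g (- real n)..g (real n)}"
    then have "\<exists>x. - real n \<le> x \<and> x \<le> real n \<and> g x = y"
      by (intro IVT') (auto intro: continuous_on_subset[OF contg])
    then show "y \<in> range g" by auto
  qed
  \<comment> \<open>Substitution on compact intervals gives \<open>?I n = ?J n\<close>. Both sides
    increase with \<open>n\<close>, so monotone convergence identifies the two limits, whether
    \<open>range g\<close> is bounded or not.\<close>
  let ?I = "\<lambda>n::nat. \<integral>\<^sup>+x. ennreal (f x) * indicator {g (- real n)..g (real n)} x \<partial>lborel"
  let ?J = "\<lambda>n::nat. \<integral>\<^sup>+x. ennreal (f (g x) * g' x) * indicator {- real n..real n} x \<partial>lborel"
  have eq: "?I n = ?J n" for n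
  proof -
    have "?I n = (\<integral>\<^sup>+x. ennreal (f x * indicator {g (- real n)..g (real n)} x) \<partial>lborel)"
      by (intro nn_integral_cong) (auto split: split_indicator)
    also have "\<dots> = (\<integral>\<^sup>+x. ennreal (f (g x) * g' x * indicator {- real n..real n} x) \<partial>lborel)"
      by (intro nn_integral_substitution deriv nonneg continuous_on_subset[OF cont])
         (auto simp: set_borel_measurable_def)
    also have "\<dots> = ?J n"
      by (intro nn_integral_cong) (auto split: split_indicator)
    finally show ?thesis .
  qed
  show "?I \<longlonglongrightarrow> (\<integral>\<^sup>+x. ennreal (f x) * indicator (range g) x \<partial>lborel)"
  proof (rule nn_integral_LIMSEQ)
    show "incseq (\<lambda>n x. ennreal (f x) * indicator {g (- real n)..g (real n)} x)"
    proof (intro incseq_SucI le_funI mult_left_mono)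
      fix n x
      have "g (- real (Suc n)) \<le> g (- real n)" "g (real n) \<le> g (real (Suc n))"
        by (auto intro!: mono)
      then show "indicator {g (- real n)..g (real n)} x \<le> (indicator {g (- real (Suc n))..g (real (Suc n))} x :: ennreal)"
        by (auto split: split_indicator)
    qed auto
    show "(\<lambda>n. ennreal (f x) * indicator {g (- real n)..g (real n)} x) \<longlonglongrightarrow> ennreal (f x) * indicator (range g) x" for x
    proof -
      have "\<forall>\<^sub>F n in sequentially. x \<in> {g (- real n)..g (real n)} \<longleftrightarrow> x \<in> range g"
      proof (cases "x \<in> range g")
        case True
        then obtain N where N: "x \<in> {g (- real N)..g (real N)}" unfolding R by blast
        have "x \<in> {g (- real n)..g (real n)}" if "n \<ge> N" for n
          using N mono[of "- real n" "- real N"] mono[of "real N" "real n"] that by auto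
        then show ?thesis
          using True unfolding eventually_sequentially by blast
      next
        case False
        then have "x \<notin> {g (- real n)..g (real n)}" for n
          unfolding R by blast
        then show ?thesis using False by simp
      qed
      then show ?thesis
        by (intro tendsto_eventually, elim eventually_mono) (auto simp: indicator_def)
    qed
  qed measurable
  show "?I \<longlonglongrightarrow> (\<integral>\<^sup>+x. ennreal (f (g x) * g' x) \<partial>lborel)"
    unfolding eq
  proof (rule nn_integral_LIMSEQ)
    show "incseq (\<lambda>n x. ennreal (f (g x) * g' x) * indicator {- real n..real n} x)"
      by (intro incseq_SucI le_funI mult_left_mono) (auto split: split_indicator)
    show "(\<lambda>n. ennreal (f (g x) * g' x) * indicator {- real n..real n} x) \<longlonglongrightarrow> ennreal (f (g x) * g' x)" for x
    proof (rule tendsto_eventually)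
      obtain N :: nat where "\<bar>x\<bar> \<le> real N" using real_arch_simple by blast
      then show "\<forall>\<^sub>F n in sequentially. ennreal (f (g x) * g' x) * indicator {- real n..real n} x = ennreal (f (g x) * g' x)"
        unfolding eventually_sequentially by (intro exI[of _ N]) (auto simp: indicator_def)
    qed
  qed measurable
qed

lemma nn_integral_real_shift:
  fixes f :: "real \<Rightarrow> ennreal"
  assumes "f \<in> borel_measurable borel"
  shows "(\<integral>\<^sup>+x. f (c + x) \<partial>lborel) = (\<integral>\<^sup>+x. f x \<partial>lborel)"
  using nn_integral_real_affine[OF assms, of 1 c] by simp

lemma nn_integral_real_reflect:
  fixes f :: "real \<Rightarrow> ennreal"
  assumes "f \<in> borel_measurable borel"
  shows "(\<integral>\<^sup>+x. f (- x) \<partial>lborel) = (\<integral>\<^sup>+x. f x \<partial>lborel)"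
  using nn_integral_real_affine[OF assms, of "-1" 0] by simp

lemma nn_integral_exp_substitution:
  fixes f :: "real \<Rightarrow> real"
  assumes "f \<in> borel_measurable borel"
  shows "(\<integral>\<^sup>+x. ennreal (f x) * indicator {0<..} x \<partial>lborel) = (\<integral>\<^sup>+t. ennreal (f (exp t) * exp t) \<partial>lborel)"
proof -
  have "range exp = {0::real<..}"
    by (auto simp: image_iff) (metis exp_ln)
  then show ?thesis
    using nn_integral_substitution_range[OF assms DERIV_exp continuous_on_exp[OF continuous_on_id]]
    by simp
qed

text \<open>The logistic function \<open>u\<close> solves \<open>u' = u * (1 - u)\<close>, hence the
  extra factor. In the moment formula it raises the exponent \<open>m\<close> of
  \<open>u * (1 - u)\<close> to the exponent \<open>m + 1\<close> of the denominator, so that a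
  single power remains.\<close>

lemma nn_integral_logistic_substitution:
  fixes f :: "real \<Rightarrow> real"
  assumes [measurable]: "f \<in> borel_measurable borel"
  shows "(\<integral>\<^sup>+u. ennreal (f u) * indicator {0<..<1} u \<partial>lborel)
    = (\<integral>\<^sup>+r. ennreal (f (1 / (1 + exp (- r))) * (1 / (1 + exp (- r)) * (1 - 1 / (1 + exp (- r))))) \<partial>lborel)"
proof -
  let ?g = "\<lambda>r::real. 1 / (1 + exp (- r))"
  have pos: "1 + exp (- r) > 0" for r :: real
    using exp_gt_zero[of "- r"] by linarith
  have "range ?g = {0<..<1}"
  proof safe
    fix u :: real assume u: "u \<in> {0<..<1}"
    then have "exp (- ln (u / (1 - u))) = (1 - u) / u"
      by (simp add: exp_minus)
    moreover have "1 + (1 - u) / u = 1 / u"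
      using u by (simp add: field_simps)
    ultimately have "?g (ln (u / (1 - u))) = u"
      using u by simp
    then show "u \<in> range ?g" by (metis rangeI)
  qed (use pos in \<open>auto simp: field_simps\<close>)
  moreover have "(?g has_real_derivative ?g x * (1 - ?g x)) (at x)" for x
    using pos[of x] by (auto intro!: derivative_eq_intros simp: field_simps power2_eq_square)
  moreover have "continuous_on UNIV (\<lambda>x. ?g x * (1 - ?g x))"
    by (intro continuous_intros) (use pos in \<open>auto simp: less_imp_neq[symmetric]\<close>)
  moreover have "?g x * (1 - ?g x) \<ge> 0" for x
    using pos[of x] by (auto simp: field_simps)
  ultimately show ?thesis
    using nn_integral_substitution_range[OF assms, of ?g "\<lambda>x. ?g x * (1 - ?g x)"] by simp
qed

lemma nn_integral_even:
  fixes f :: "real \<Rightarrow> ennreal"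
  assumes [measurable]: "f \<in> borel_measurable borel" and even: "\<And>x. f (- x) = f x"
  shows "(\<integral>\<^sup>+x. f x \<partial>lborel) = 2 * (\<integral>\<^sup>+x. f x * indicator {0<..} x \<partial>lborel)"
proof -
  have "(\<integral>\<^sup>+x. f x \<partial>lborel) = (\<integral>\<^sup>+x. f x * indicator {0<..} x + f x * indicator {..<0} x \<partial>lborel)"
    by (intro nn_integral_cong_AE, rule AE_mp[OF AE_lborel_singleton[of 0]])
       (auto simp: indicator_def)
  also have "\<dots> = (\<integral>\<^sup>+x. f x * indicator {0<..} x \<partial>lborel) + (\<integral>\<^sup>+x. f x * indicator {..<0} x \<partial>lborel)"
    by (intro nn_integral_add) auto
  also have "(\<integral>\<^sup>+x. f x * indicator {..<0} x \<partial>lborel) = (\<integral>\<^sup>+x. f (- x) * indicator {..<0} (- x) \<partial>lborel)"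
    by (rule nn_integral_real_reflect[symmetric]) measurable
  also have "\<dots> = (\<integral>\<^sup>+x. f x * indicator {0<..} x \<partial>lborel)"
    by (intro nn_integral_cong) (auto simp: even indicator_def)
  finally show ?thesis by (simp add: mult_2)
qed

section \<open>Comparison of the Bessel function with a Gaussian integral\<close>

lemma cosh_real_ge_quadratic: "1 + t\<^sup>2 / 2 \<le> cosh (t :: real)"
proof -
  have *: "x \<le> sinh x" if "x \<ge> 0" for x :: real
  proof -
    have "(\<lambda>x. sinh x - x) 0 \<le> (\<lambda>x::real. sinh x - x) x"
    proof (rule DERIV_nonneg_imp_nondecreasing[OF that])
      fix y :: real
      show "\<exists>z. ((\<lambda>x. sinh x - x) has_real_derivative z) (at y) \<and> 0 \<le> z"
        by (intro exI[of _ "cosh y - 1"]) (auto intro!: derivative_eq_intros simp: cosh_real_ge_1)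
    qed
    then show ?thesis by simp
  qed
  \<comment> \<open>The bound \<open>x \<le> sinh x\<close> is inserted into the half-angle identity
    for \<open>cosh\<close>; the modulus reduces to a nonnegative argument.\<close>
  have "(\<bar>t\<bar> / 2)\<^sup>2 \<le> (sinh (\<bar>t\<bar> / 2))\<^sup>2"
    by (intro power_mono *) auto
  moreover have "cosh \<bar>t\<bar> = 1 + 2 * (sinh (\<bar>t\<bar> / 2))\<^sup>2"
    using cosh_double[of "\<bar>t\<bar> / 2"] cosh_square_eq[of "\<bar>t\<bar> / 2"] by simp
  ultimately show ?thesis by (simp add: power2_eq_square)
qed

lemma nn_integral_gaussian:
  assumes "c > 0"
  shows "(\<integral>\<^sup>+t. ennreal (exp (- c * t\<^sup>2 / 2)) \<partial>lborel) = ennreal (sqrt (2 * pi / c))"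
proof -
  interpret prob_space "density lborel (normal_density 0 (1 / sqrt c))"
    using assms by (intro prob_space_normal_density) auto
  have eq: "exp (- c * t\<^sup>2 / 2) = sqrt (2 * pi / c) * normal_density 0 (1 / sqrt c) t" for t
    using assms by (simp add: normal_density_def field_simps power2_eq_square real_sqrt_divide real_sqrt_mult)
  have "(\<integral>\<^sup>+t. ennreal (normal_density 0 (1 / sqrt c) t) \<partial>lborel) = 1"
    using emeasure_space_1 by (simp add: emeasure_density)
  then show ?thesis
    using assms unfolding eq by (subst ennreal_mult) (auto simp: nn_integral_cmult)
qed

lemma bessel_K0_nonneg: "bessel_K0 x \<ge> 0"
  unfolding bessel_K0_def set_lebesgue_integral_def by (intro integral_nonneg_AE) auto

text \<open>The quadratic lower bound for \<open>cosh\<close> puts a Gaussian above the integrand.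
  This gives the upper bound and, at the same time, the finiteness without which
  \<open>bessel_K0\<close>, a Bochner integral with default value 0, could not be identified with
  the nonnegative integral.\<close>

lemma nn_integral_bessel_K0:
  assumes "x > 0"
  shows "(\<integral>\<^sup>+t. ennreal (exp (- x * cosh t)) \<partial>lborel) = ennreal (2 * bessel_K0 x)"
    and bessel_K0_le: "bessel_K0 x \<le> sqrt (pi / (2 * x)) * exp (- x)"
proof -
  let ?I = "\<integral>\<^sup>+t. ennreal (exp (- x * cosh t)) * indicator {0<..} t \<partial>lborel"
  have [measurable]: "(cosh :: real \<Rightarrow> real) \<in> borel_measurable borel"
    by (intro borel_measurable_continuous_onI continuous_intros)
  have two: "(\<integral>\<^sup>+t. ennreal (exp (- x * cosh t)) \<partial>lborel) = 2 * ?I"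
    by (rule nn_integral_even) auto
  have "(\<integral>\<^sup>+t. ennreal (exp (- x * cosh t)) \<partial>lborel)
     \<le> (\<integral>\<^sup>+t. ennreal (exp (- x)) * ennreal (exp (- x * t\<^sup>2 / 2)) \<partial>lborel)"
  proof (rule nn_integral_mono)
    fix t :: real
    have "x * (1 + t\<^sup>2 / 2) \<le> x * cosh t"
      using assms cosh_real_ge_quadratic by (intro mult_left_mono) auto
    then have "exp (- x * cosh t) \<le> exp (- x + - x * t\<^sup>2 / 2)"
      by (simp add: field_simps)
    then show "ennreal (exp (- x * cosh t)) \<le> ennreal (exp (- x)) * ennreal (exp (- x * t\<^sup>2 / 2))"
      unfolding exp_add by (simp add: ennreal_leI flip: ennreal_mult)
  qed
  also have "\<dots> = ennreal (exp (- x) * sqrt (2 * pi / x))"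
    using assms by (simp add: nn_integral_cmult nn_integral_gaussian[of x, simplified] ennreal_mult')
  finally have le: "2 * ?I \<le> ennreal (exp (- x) * sqrt (2 * pi / x))" unfolding two .
  have "?I \<le> 2 * ?I" by (simp add: mult_2)
  with le have fin: "?I < \<infinity>"
    using le_less_trans[OF order_trans ennreal_less_top] by auto
  have I: "?I = ennreal (bessel_K0 x)"
  proof -
    have "bessel_K0 x = enn2real (\<integral>\<^sup>+t. ennreal (indicat_real {0..} t * exp (- x * cosh t)) \<partial>lborel)"
      unfolding bessel_K0_def set_lebesgue_integral_def
      by (subst integral_eq_nn_integral) auto
    also have "(\<integral>\<^sup>+t. ennreal (indicat_real {0..} t * exp (- x * cosh t)) \<partial>lborel) = ?I"
      by (intro nn_integral_cong_AE, rule AE_mp[OF AE_lborel_singleton[of 0]])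
         (auto simp: indicator_def)
    finally show ?thesis using fin by simp
  qed
  have J: "2 * ?I = ennreal (2 * bessel_K0 x)"
    unfolding I using bessel_K0_nonneg[of x] by (simp add: ennreal_mult')
  with two show "(\<integral>\<^sup>+t. ennreal (exp (- x * cosh t)) \<partial>lborel) = ennreal (2 * bessel_K0 x)" by simp
  have "2 * bessel_K0 x \<le> exp (- x) * sqrt (2 * pi / x)"
    using le assms unfolding J by (subst (asm) ennreal_le_iff) auto
  also have "sqrt (2 * pi / x) = sqrt (2\<^sup>2 * (pi / (2 * x)))"
    using assms by (simp add: field_simps)
  also have "\<dots> = 2 * sqrt (pi / (2 * x))"
    unfolding real_sqrt_mult by simp
  finally show "bessel_K0 x \<le> sqrt (pi / (2 * x)) * exp (- x)" by (simp add: mult_ac)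
qed

lemma borel_measurable_bessel_K0 [measurable]: "bessel_K0 \<in> borel_measurable borel"
proof -
  have [measurable]: "(cosh :: real \<Rightarrow> real) \<in> borel_measurable borel"
    by (intro borel_measurable_continuous_onI continuous_intros)
  show ?thesis
    unfolding bessel_K0_def[abs_def] set_lebesgue_integral_def by measurable
qed

subsection \<open>Moments of products of Bessel functions\<close>

text \<open>Translating by \<open>ln (sqrt (\<beta> / \<alpha>))\<close> balances both coefficients
  to \<open>sqrt (\<alpha> * \<beta>)\<close>, and the exponent becomes a multiple of
  \<open>cosh\<close>. This form of the Bessel function serves both the moments and the density of a
  product.\<close>

lemma nn_integral_exp_exp_minus:
  assumes "\<alpha> > 0" "\<beta> > 0"
  shows "(\<integral>\<^sup>+t. ennreal (exp (- (\<alpha> * exp t + \<beta> * exp (- t)))) \<partial>lborel)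
    = ennreal (2 * bessel_K0 (2 * sqrt (\<alpha> * \<beta>)))"
proof -
  let ?c = "ln (sqrt (\<beta> / \<alpha>))"
  have eq: "\<alpha> * exp (?c + t) + \<beta> * exp (- (?c + t)) = 2 * sqrt (\<alpha> * \<beta>) * cosh t" for t
  proof -
    have 1: "\<alpha> * sqrt (\<beta> / \<alpha>) = sqrt (\<alpha> * \<beta>)" and 2: "\<beta> / sqrt (\<beta> / \<alpha>) = sqrt (\<alpha> * \<beta>)"
      using assms by (auto simp: real_sqrt_divide real_sqrt_mult field_simps)
    have "\<alpha> * exp (?c + t) = sqrt (\<alpha> * \<beta>) * exp t"
      using assms by (simp add: exp_add 1[symmetric])
    moreover have "\<beta> * exp (- (?c + t)) = sqrt (\<alpha> * \<beta>) * exp (- t)"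
      using assms by (simp add: exp_add exp_diff exp_minus 2[symmetric] field_simps)
    ultimately show ?thesis
      by (simp add: cosh_def field_simps)
  qed
  have "(\<integral>\<^sup>+t. ennreal (exp (- (\<alpha> * exp t + \<beta> * exp (- t)))) \<partial>lborel)
     = (\<integral>\<^sup>+t. ennreal (exp (- (\<alpha> * exp (?c + t) + \<beta> * exp (- (?c + t))))) \<partial>lborel)"
    by (rule nn_integral_real_shift[symmetric]) measurable
  also have "\<dots> = (\<integral>\<^sup>+t. ennreal (exp (- (2 * sqrt (\<alpha> * \<beta>) * cosh t))) \<partial>lborel)"
    unfolding eq by (rule refl)
  finally show ?thesis
    using nn_integral_bessel_K0(1)[of "2 * sqrt (\<alpha> * \<beta>)"] assms by simp
qed

text \<open>Translating by \<open>- ln \<kappa>\<close> normalises the rate to 1 and produces the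
  power of \<open>\<kappa>\<close>; with \<open>x = exp t\<close> the rest is the Gamma integral for
  \<open>fact m\<close>.\<close>

lemma nn_integral_gamma_exp:
  assumes "\<kappa> > 0"
  shows "(\<integral>\<^sup>+t. ennreal (exp t ^ (m + 1) * exp (- \<kappa> * exp t)) \<partial>lborel) = ennreal (fact m / \<kappa> ^ (m + 1))"
proof -
  let ?c = "- ln \<kappa>"
  have "(\<integral>\<^sup>+t. ennreal (exp t ^ (m + 1) * exp (- \<kappa> * exp t)) \<partial>lborel)
     = (\<integral>\<^sup>+t. ennreal (exp (?c + t) ^ (m + 1) * exp (- \<kappa> * exp (?c + t))) \<partial>lborel)"
    by (rule nn_integral_real_shift[symmetric]) measurable
  also have "\<dots> = (\<integral>\<^sup>+t. ennreal (1 / \<kappa> ^ (m + 1)) * ennreal (exp t ^ m * exp (- exp t) * exp t) \<partial>lborel)"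
    using assms by (intro nn_integral_cong)
      (simp add: exp_diff exp_add exp_minus field_simps flip: ennreal_mult)
  also have "\<dots> = ennreal (1 / \<kappa> ^ (m + 1)) * (\<integral>\<^sup>+t. ennreal (exp t ^ m * exp (- exp t) * exp t) \<partial>lborel)"
    by (rule nn_integral_cmult) measurable
  also have "(\<integral>\<^sup>+t. ennreal (exp t ^ m * exp (- exp t) * exp t) \<partial>lborel)
      = (\<integral>\<^sup>+x. ennreal (x ^ m * exp (- x)) * indicator {0<..} x \<partial>lborel)"
    using nn_integral_exp_substitution[of "\<lambda>x. x ^ m * exp (- x)"] by simp
  also have "\<dots> = (\<integral>\<^sup>+x. ennreal (x ^ m * exp (- x)) * indicator {0..} x \<partial>lborel)"
      by (intro nn_integral_cong_AE, rule AE_mp[OF AE_lborel_singleton[of 0]])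
         (auto simp: indicator_def)
  also have "\<dots> = ennreal (fact m)"
    using nn_intergal_power_times_exp_Ici[of m] by simp
  finally show ?thesis
    using assms by (simp flip: ennreal_mult)
qed

text \<open>Replacing \<open>t\<close> by \<open>t / 2\<close> reduces to the previous integral,
  with Jacobian \<open>1 / 2\<close>. The exponent is \<open>2 * m + 2\<close> because the power
  \<open>2 * m + 1\<close> of \<open>w = exp \<tau>\<close> gains one more factor from the
  differential.\<close>

lemma nn_integral_gamma_exp_square:
  assumes "\<kappa> > 0"
  shows "(\<integral>\<^sup>+t. ennreal (exp t ^ (2 * m + 2) * exp (- \<kappa> * (exp t)\<^sup>2)) \<partial>lborel) = ennreal (fact m / (2 * \<kappa> ^ (m + 1)))"
proof -
  have eq: "exp (0 + 1 / 2 * t) ^ (2 * m + 2) * exp (- \<kappa> * (exp (0 + 1 / 2 * t))\<^sup>2)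
     = exp t ^ (m + 1) * exp (- \<kappa> * exp t)" for t :: real
  proof -
    have "exp (t / 2) ^ 2 = exp t"
      unfolding power2_eq_square exp_add[symmetric] by simp
    moreover have "exp (t / 2) ^ (2 * m + 2) = (exp (t / 2) ^ 2) ^ (m + 1)"
      by (simp only: power_mult[symmetric]) simp
    ultimately show ?thesis by simp
  qed
  have "(\<integral>\<^sup>+t. ennreal (exp t ^ (2 * m + 2) * exp (- \<kappa> * (exp t)\<^sup>2)) \<partial>lborel)
    = ennreal \<bar>1 / 2\<bar> * (\<integral>\<^sup>+t. ennreal (exp (0 + 1 / 2 * t) ^ (2 * m + 2) * exp (- \<kappa> * (exp (0 + 1 / 2 * t))\<^sup>2)) \<partial>lborel)"
    by (rule nn_integral_real_affine) auto
  also have "\<dots> = ennreal (1 / 2) * ennreal (fact m / \<kappa> ^ (m + 1))"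
    unfolding eq nn_integral_gamma_exp[OF assms] by simp
  also have "\<dots> = ennreal (1 / 2 * (fact m / \<kappa> ^ (m + 1)))"
    using assms by (intro ennreal_mult[symmetric]) auto
  finally show ?thesis by simp
qed

text \<open>With \<open>\<alpha> = a\<^sup>2\<close> and \<open>\<beta> = w\<^sup>2 / 4\<close> one
  has \<open>2 * sqrt (\<alpha> * \<beta>) = a * w\<close>, and \<open>w\<close> enters only through
  a Gaussian factor. The shift \<open>t\<close> is free by translation invariance; for the second
  Bessel factor it becomes the variable of the first, so that \<open>r\<close> is the difference of
  the two variables.\<close>

lemma bessel_K0_eq_nn_integral:
  assumes "a > 0"
  shows "ennreal (2 * bessel_K0 (a * exp \<tau>))
    = (\<integral>\<^sup>+r. ennreal (exp (- (a\<^sup>2 * exp (t + r) + (exp \<tau>)\<^sup>2 / 4 * exp (- (t + r))))) \<partial>lborel)"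
proof -
  have "sqrt (a\<^sup>2 * ((exp \<tau>)\<^sup>2 / 4)) = a * exp \<tau> / 2"
    using assms by (simp add: real_sqrt_mult real_sqrt_divide)
  then have "2 * sqrt (a\<^sup>2 * ((exp \<tau>)\<^sup>2 / 4)) = a * exp \<tau>" by simp
  then have "ennreal (2 * bessel_K0 (a * exp \<tau>))
    = (\<integral>\<^sup>+r. ennreal (exp (- (a\<^sup>2 * exp r + (exp \<tau>)\<^sup>2 / 4 * exp (- r)))) \<partial>lborel)"
    using assms by (subst nn_integral_exp_exp_minus) auto
  also have "\<dots> = (\<integral>\<^sup>+r. ennreal (exp (- (a\<^sup>2 * exp (t + r) + (exp \<tau>)\<^sup>2 / 4 * exp (- (t + r))))) \<partial>lborel)"
    by (rule nn_integral_real_shift[symmetric]) measurable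
  finally show ?thesis .
qed

text \<open>Integrating over \<open>\<tau>\<close> yields the power \<open>- (m + 1)\<close> of the
  Gaussian rate \<open>exp (- t) * (1 + exp (- r)) / 4\<close>. Its factor
  \<open>exp t ^ (m + 1)\<close> is exactly what the Gamma integral over \<open>t\<close> needs, and
  each of the two integrals contributes one \<open>fact m\<close>.\<close>

lemma nn_integral_moment_bessel_K0:
  assumes a: "a > 0" and b: "b > 0"
  shows "(\<integral>\<^sup>+w. ennreal (w ^ (2 * m + 1) * bessel_K0 (a * w) * bessel_K0 (b * w)) * indicator {0<..} w \<partial>lborel)
    = (\<integral>\<^sup>+u. ennreal (4 ^ m * (fact m)\<^sup>2 / 2 * ((u * (1 - u)) ^ m / (a\<^sup>2 * (1 - u) + b\<^sup>2 * u) ^ (m + 1)))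
         * indicator {0<..<1} u \<partial>lborel)" (is "?L = ?R")
proof -
  define E where "E a \<tau> t = exp (- (a\<^sup>2 * exp t + (exp \<tau>)\<^sup>2 / 4 * exp (- t)))" for a \<tau> t :: real
  have [measurable]: "(\<lambda>x. E a (f x) (g x)) \<in> borel_measurable M"
    if "f \<in> borel_measurable M" "g \<in> borel_measurable M" for a f g and M :: "'x measure"
    using that unfolding E_def by measurable
  have pos: "E a \<tau> t > 0" for a \<tau> t by (simp add: E_def)
  \<comment> \<open>Here \<open>y\<close> stands for \<open>exp t\<close>, \<open>A\<close> for
    \<open>1 + exp (- r)\<close>, \<open>F\<close> for \<open>fact m\<close> and \<open>X\<close>
    for the exponential in \<open>t\<close>: the power of the Gaussian rate is separated into its
    dependence on \<open>t\<close> and on \<open>r\<close>.\<close>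
  have scale: "X * (F / (2 * (inverse y * A / 4) ^ (m + 1))) = 4 ^ (m + 1) * F / 2 / A ^ (m + 1) * (y ^ (m + 1) * X)"
    if "A > 0" "y > 0" for A X y F :: real
    using that by (simp add: power_mult_distrib power_divide power_inverse del: power_Suc) (simp add: field_simps del: power_Suc)
  have mult3: "ennreal (x * y * z) = ennreal x * ennreal y * ennreal z" if "0 \<le> x" "0 \<le> y" "0 \<le> z" for x y z
    using that by (simp add: ennreal_mult)
  define h where "h \<tau> t r = exp \<tau> ^ (2 * m + 2) * E a \<tau> t * E b \<tau> (t + r)" for \<tau> t r
  have [measurable]: "(\<lambda>x. h (f x) (g x) (k x)) \<in> borel_measurable M"
    if "f \<in> borel_measurable M" "g \<in> borel_measurable M" "k \<in> borel_measurable M" for f g k and M :: "'x measure"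
    using that unfolding h_def by measurable
  \<comment> \<open>The factor 4 supplies one 2 for each Bessel function, matching the integral over
    the whole line, which is twice \<open>bessel_K0\<close>.\<close>
  have "4 * ?L = 4 * (\<integral>\<^sup>+\<tau>. ennreal (exp \<tau> ^ (2 * m + 1) * bessel_K0 (a * exp \<tau>) * bessel_K0 (b * exp \<tau>) * exp \<tau>) \<partial>lborel)"
    by (subst nn_integral_exp_substitution) auto
  also have "\<dots> = (\<integral>\<^sup>+\<tau>. 4 * ennreal (exp \<tau> ^ (2 * m + 1) * bessel_K0 (a * exp \<tau>) * bessel_K0 (b * exp \<tau>) * exp \<tau>) \<partial>lborel)"
    by (rule nn_integral_cmult[symmetric]) measurable
  also have "\<dots> = (\<integral>\<^sup>+\<tau>. \<integral>\<^sup>+t. \<integral>\<^sup>+r. ennreal (h \<tau> t r) \<partial>lborel \<partial>lborel \<partial>lborel)"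
  proof (rule nn_integral_cong)
    fix \<tau> :: real
    have "4 * ennreal (exp \<tau> ^ (2 * m + 1) * bessel_K0 (a * exp \<tau>) * bessel_K0 (b * exp \<tau>) * exp \<tau>)
       = ennreal 4 * ennreal (exp \<tau> ^ (2 * m + 1) * bessel_K0 (a * exp \<tau>) * bessel_K0 (b * exp \<tau>) * exp \<tau>)"
      by simp
    also have "\<dots> = ennreal (4 * (exp \<tau> ^ (2 * m + 1) * bessel_K0 (a * exp \<tau>) * bessel_K0 (b * exp \<tau>) * exp \<tau>))"
      by (rule ennreal_mult[symmetric]) (auto simp: bessel_K0_nonneg)
    also have "4 * (exp \<tau> ^ (2 * m + 1) * bessel_K0 (a * exp \<tau>) * bessel_K0 (b * exp \<tau>) * exp \<tau>)
      = exp \<tau> ^ (2 * m + 2) * (2 * bessel_K0 (a * exp \<tau>)) * (2 * bessel_K0 (b * exp \<tau>))"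
      by simp
    also have "ennreal \<dots> = ennreal (exp \<tau> ^ (2 * m + 2)) * ennreal (2 * bessel_K0 (a * exp \<tau>)) * ennreal (2 * bessel_K0 (b * exp \<tau>))"
      by (rule mult3) (auto simp: bessel_K0_nonneg)
    also have "ennreal (2 * bessel_K0 (a * exp \<tau>)) = (\<integral>\<^sup>+t. ennreal (E a \<tau> t) \<partial>lborel)"
      unfolding E_def using bessel_K0_eq_nn_integral[OF a, of \<tau> 0] by simp
    also have "ennreal (exp \<tau> ^ (2 * m + 2)) * (\<integral>\<^sup>+t. ennreal (E a \<tau> t) \<partial>lborel) * ennreal (2 * bessel_K0 (b * exp \<tau>))
       = (\<integral>\<^sup>+t. ennreal (exp \<tau> ^ (2 * m + 2)) * ennreal (E a \<tau> t) * ennreal (2 * bessel_K0 (b * exp \<tau>)) \<partial>lborel)"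
      by (simp add: nn_integral_cmult nn_integral_multc)
    also have "\<dots> = (\<integral>\<^sup>+t. \<integral>\<^sup>+r. ennreal (h \<tau> t r) \<partial>lborel \<partial>lborel)"
    proof (rule nn_integral_cong)
      fix t :: real
      have "ennreal (2 * bessel_K0 (b * exp \<tau>)) = (\<integral>\<^sup>+r. ennreal (E b \<tau> (t + r)) \<partial>lborel)"
        unfolding E_def using bessel_K0_eq_nn_integral[OF b, of \<tau> t] by simp
      then have "ennreal (exp \<tau> ^ (2 * m + 2)) * ennreal (E a \<tau> t) * ennreal (2 * bessel_K0 (b * exp \<tau>))
        = (\<integral>\<^sup>+r. ennreal (exp \<tau> ^ (2 * m + 2)) * ennreal (E a \<tau> t) * ennreal (E b \<tau> (t + r)) \<partial>lborel)"
        by (simp add: nn_integral_cmult)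
      also have "\<dots> = (\<integral>\<^sup>+r. ennreal (h \<tau> t r) \<partial>lborel)"
        unfolding h_def using pos by (intro nn_integral_cong) (simp add: ennreal_mult less_imp_le)
      finally show "ennreal (exp \<tau> ^ (2 * m + 2)) * ennreal (E a \<tau> t) * ennreal (2 * bessel_K0 (b * exp \<tau>)) = \<dots>" .
    qed
    finally show "4 * ennreal (exp \<tau> ^ (2 * m + 1) * bessel_K0 (a * exp \<tau>) * bessel_K0 (b * exp \<tau>) * exp \<tau>) = \<dots>" .
  qed
  \<comment> \<open>Three Tonelli swaps move \<open>\<tau>\<close> from the outermost to the
    innermost place and \<open>r\<close> to the outermost, so that both Gamma integrals are inner
    ones.\<close>
  also have "\<dots> = (\<integral>\<^sup>+\<tau>. \<integral>\<^sup>+r. \<integral>\<^sup>+t. ennreal (h \<tau> t r) \<partial>lborel \<partial>lborel \<partial>lborel)"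
    by (intro nn_integral_cong lborel_pair.Fubini') measurable
  also have "\<dots> = (\<integral>\<^sup>+r. \<integral>\<^sup>+\<tau>. \<integral>\<^sup>+t. ennreal (h \<tau> t r) \<partial>lborel \<partial>lborel \<partial>lborel)"
    by (intro lborel_pair.Fubini') measurable
  also have "\<dots> = (\<integral>\<^sup>+r. \<integral>\<^sup>+t. \<integral>\<^sup>+\<tau>. ennreal (h \<tau> t r) \<partial>lborel \<partial>lborel \<partial>lborel)"
    by (intro nn_integral_cong lborel_pair.Fubini') measurable
  also have "\<dots> = (\<integral>\<^sup>+r. ennreal (4 ^ (m + 1) * (fact m)\<^sup>2 / 2 / ((1 + exp (- r)) * (a\<^sup>2 + b\<^sup>2 * exp r)) ^ (m + 1)) \<partial>lborel)"
  proof (rule nn_integral_cong)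
    fix r :: real
    have pos1: "1 + exp (- r) > 0" by (simp add: add_pos_pos)
    have pos2: "a\<^sup>2 + b\<^sup>2 * exp r > 0" using a by (intro add_pos_nonneg) auto
    have "(\<integral>\<^sup>+\<tau>. ennreal (h \<tau> t r) \<partial>lborel) = ennreal (4 ^ (m + 1) * fact m / 2 / (1 + exp (- r)) ^ (m + 1))
        * ennreal (exp t ^ (m + 1) * exp (- (a\<^sup>2 + b\<^sup>2 * exp r) * exp t))" for t
    proof -
      let ?\<kappa> = "exp (- t) * (1 + exp (- r)) / 4"
      have \<kappa>: "?\<kappa> > 0" using pos1 by simp
      have "h \<tau> t r = exp (- (a\<^sup>2 + b\<^sup>2 * exp r) * exp t) * (exp \<tau> ^ (2 * m + 2) * exp (- ?\<kappa> * (exp \<tau>)\<^sup>2))" for \<tau>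
      proof -
        have "E a \<tau> t * E b \<tau> (t + r) = exp (- (a\<^sup>2 * exp t + (exp \<tau>)\<^sup>2 / 4 * exp (- t)) + - (b\<^sup>2 * exp (t + r) + (exp \<tau>)\<^sup>2 / 4 * exp (- (t + r))))"
          unfolding E_def by (rule exp_add[symmetric])
        also have "- (a\<^sup>2 * exp t + (exp \<tau>)\<^sup>2 / 4 * exp (- t)) + - (b\<^sup>2 * exp (t + r) + (exp \<tau>)\<^sup>2 / 4 * exp (- (t + r)))
            = - (a\<^sup>2 + b\<^sup>2 * exp r) * exp t + - ?\<kappa> * (exp \<tau>)\<^sup>2"
        proof -
          have "exp (- (t + r)) = exp (- t) * exp (- r)" "exp (t + r) = exp t * exp r"
            by (simp_all add: exp_add[symmetric])
          then show ?thesis by algebra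
        qed
        finally show ?thesis unfolding h_def exp_add by (simp add: mult_ac)
      qed
      then have "(\<integral>\<^sup>+\<tau>. ennreal (h \<tau> t r) \<partial>lborel) = ennreal (exp (- (a\<^sup>2 + b\<^sup>2 * exp r) * exp t))
          * ennreal (fact m / (2 * ?\<kappa> ^ (m + 1)))"
        unfolding nn_integral_gamma_exp_square[OF \<kappa>, symmetric]
        by (subst nn_integral_cmult[symmetric]) (auto simp: ennreal_mult')
      also have "\<dots> = ennreal (exp (- (a\<^sup>2 + b\<^sup>2 * exp r) * exp t) * (fact m / (2 * ?\<kappa> ^ (m + 1))))"
        using \<kappa> by (intro ennreal_mult[symmetric]) auto
      also have "exp (- (a\<^sup>2 + b\<^sup>2 * exp r) * exp t) * (fact m / (2 * ?\<kappa> ^ (m + 1)))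
        = 4 ^ (m + 1) * fact m / 2 / (1 + exp (- r)) ^ (m + 1) * (exp t ^ (m + 1) * exp (- (a\<^sup>2 + b\<^sup>2 * exp r) * exp t))"
        using scale[OF pos1 exp_gt_zero[of t]] by (simp only: exp_minus[of t])
      also have "ennreal \<dots> = ennreal (4 ^ (m + 1) * fact m / 2 / (1 + exp (- r)) ^ (m + 1))
        * ennreal (exp t ^ (m + 1) * exp (- (a\<^sup>2 + b\<^sup>2 * exp r) * exp t))"
        using pos1 by (intro ennreal_mult) auto
      finally show ?thesis .
    qed
    then have "(\<integral>\<^sup>+t. \<integral>\<^sup>+\<tau>. ennreal (h \<tau> t r) \<partial>lborel \<partial>lborel)
      = ennreal (4 ^ (m + 1) * fact m / 2 / (1 + exp (- r)) ^ (m + 1)) * ennreal (fact m / (a\<^sup>2 + b\<^sup>2 * exp r) ^ (m + 1))"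
      unfolding nn_integral_gamma_exp[OF pos2, symmetric] by (subst nn_integral_cmult[symmetric]) auto
    also have "\<dots> = ennreal (4 ^ (m + 1) * fact m / 2 / (1 + exp (- r)) ^ (m + 1) * (fact m / (a\<^sup>2 + b\<^sup>2 * exp r) ^ (m + 1)))"
      using pos1 pos2 by (intro ennreal_mult[symmetric]) auto
    also have "4 ^ (m + 1) * fact m / 2 / (1 + exp (- r)) ^ (m + 1) * (fact m / (a\<^sup>2 + b\<^sup>2 * exp r) ^ (m + 1))
       = 4 ^ (m + 1) * (fact m)\<^sup>2 / 2 / ((1 + exp (- r)) * (a\<^sup>2 + b\<^sup>2 * exp r)) ^ (m + 1)"
      by (simp add: power_mult_distrib power2_eq_square del: power_Suc)
    finally show "(\<integral>\<^sup>+t. \<integral>\<^sup>+\<tau>. ennreal (h \<tau> t r) \<partial>lborel \<partial>lborel) = ennreal \<dots>" .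
  qed
  also have "\<dots> = (\<integral>\<^sup>+u. ennreal (4 ^ (m + 1) * (fact m)\<^sup>2 / 2 * ((u * (1 - u)) ^ m / (a\<^sup>2 * (1 - u) + b\<^sup>2 * u) ^ (m + 1)))
         * indicator {0<..<1} u \<partial>lborel)"
  proof (subst nn_integral_logistic_substitution)
    have "(1 / (1 + exp (- r)) * (1 - 1 / (1 + exp (- r)))) ^ m / (a\<^sup>2 * (1 - 1 / (1 + exp (- r))) + b\<^sup>2 * (1 / (1 + exp (- r)))) ^ (m + 1)
       * (1 / (1 + exp (- r)) * (1 - 1 / (1 + exp (- r)))) = 1 / ((1 + exp (- r)) * (a\<^sup>2 + b\<^sup>2 * exp r)) ^ (m + 1)" for r :: real
    proof -
      define u where "u = 1 / (1 + exp (- r))"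
      have pos1: "1 + exp (- r) > 0" by (simp add: add_pos_pos)
      have pos2: "a\<^sup>2 + b\<^sup>2 * exp r > 0" using a by (intro add_pos_nonneg) auto
      have u: "0 < u" "u < 1" using pos1 by (auto simp: u_def field_simps)
      have "u * exp (- r) = 1 - u" using pos1 by (simp add: u_def field_simps)
      then have er: "u = (1 - u) * exp r" by (simp add: exp_minus field_simps)
      \<comment> \<open>Since \<open>exp r = u / (1 - u)\<close>, the factor \<open>1 - u\<close>
        can be taken out of the linear denominator and cancels against the one in the
        numerator.\<close>
      have D: "a\<^sup>2 * (1 - u) + b\<^sup>2 * u = (1 - u) * (a\<^sup>2 + b\<^sup>2 * exp r)"
        using er by algebra
      have "(u * (1 - u)) ^ m / (a\<^sup>2 * (1 - u) + b\<^sup>2 * u) ^ (m + 1) * (u * (1 - u))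
         = (u * (1 - u) / (a\<^sup>2 * (1 - u) + b\<^sup>2 * u)) ^ (m + 1)"
        by (simp add: power_divide)
      also have "u * (1 - u) / (a\<^sup>2 * (1 - u) + b\<^sup>2 * u) = u / (a\<^sup>2 + b\<^sup>2 * exp r)"
        unfolding D using u pos2 by simp
      also have "\<dots> = 1 / ((1 + exp (- r)) * (a\<^sup>2 + b\<^sup>2 * exp r))"
        by (simp add: u_def)
      finally show ?thesis unfolding u_def[symmetric] by (simp add: power_divide)
    qed
    then show "(\<integral>\<^sup>+r. ennreal (4 ^ (m + 1) * (fact m)\<^sup>2 / 2 / ((1 + exp (- r)) * (a\<^sup>2 + b\<^sup>2 * exp r)) ^ (m + 1)) \<partial>lborel)
     = (\<integral>\<^sup>+r. ennreal (4 ^ (m + 1) * (fact m)\<^sup>2 / 2 * ((1 / (1 + exp (- r)) * (1 - 1 / (1 + exp (- r)))) ^ m / (a\<^sup>2 * (1 - 1 / (1 + exp (- r))) + b\<^sup>2 * (1 / (1 + exp (- r)))) ^ (m + 1))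
       * (1 / (1 + exp (- r)) * (1 - 1 / (1 + exp (- r))))) \<partial>lborel)"
      by (simp only: mult.assoc) simp
  qed measurable
  also have "\<dots> = (\<integral>\<^sup>+u. ennreal 4 * (ennreal (4 ^ m * (fact m)\<^sup>2 / 2 * ((u * (1 - u)) ^ m / (a\<^sup>2 * (1 - u) + b\<^sup>2 * u) ^ (m + 1)))
         * indicator {0<..<1} u) \<partial>lborel)"
  proof (rule nn_integral_cong)
    fix u :: real
    have "ennreal (4 ^ (m + 1) * (fact m)\<^sup>2 / 2 * y) = ennreal 4 * ennreal (4 ^ m * (fact m)\<^sup>2 / 2 * y)" for y :: real
      by (subst ennreal_mult'[symmetric]) (simp_all add: mult_ac)
    then show "ennreal (4 ^ (m + 1) * (fact m)\<^sup>2 / 2 * ((u * (1 - u)) ^ m / (a\<^sup>2 * (1 - u) + b\<^sup>2 * u) ^ (m + 1))) * indicator {0<..<1} u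
       = ennreal 4 * (ennreal (4 ^ m * (fact m)\<^sup>2 / 2 * ((u * (1 - u)) ^ m / (a\<^sup>2 * (1 - u) + b\<^sup>2 * u) ^ (m + 1))) * indicator {0<..<1} u)"
      by (simp only: mult.assoc)
  qed
  also have "\<dots> = 4 * ?R"
    by (subst nn_integral_cmult) auto
  finally have "4 * ?L = 4 * ?R" .
  \<comment> \<open>In \<open>ennreal\<close> the factor 4 is removed by multiplying with its
    inverse, which needs no finiteness of \<open>?L\<close>.\<close>
  then have "ennreal (1 / 4) * (4 * ?L) = ennreal (1 / 4) * (4 * ?R)" by (rule arg_cong)
  moreover have "ennreal (1 / 4) * 4 = 1"
    using ennreal_mult[of "1 / 4" 4] by simp
  ultimately show ?thesis
    by (simp only: mult.assoc[symmetric] mult_1_left)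
qed

subsection \<open>Euler integral\<close>

lemma fact_add_pochhammer: "fact (n + k) = fact n * pochhammer (of_nat (Suc n) :: 'a :: field_char_0) k"
  using pochhammer_product'[of "1 :: 'a" n k] unfolding pochhammer_fact[symmetric] by (simp add: add.commute)

lemma has_integral_Beta_nat:
  "((\<lambda>u::real. u ^ p * (1 - u) ^ q) has_integral (fact p * fact q / fact (p + q + 1))) {0..1}"
proof -
  have "Beta (real p + 1) (real q + 1) = fact p * fact q / fact (p + q + 1)"
    using Gamma_fact[of p, where 'a = real] Gamma_fact[of q, where 'a = real] Gamma_fact[of "p + q + 1", where 'a = real]
    by (simp add: Beta_def algebra_simps)
  then have "((\<lambda>t. t powr (real p + 1 - 1) * (1 - t) powr (real q + 1 - 1)) has_integral (fact p * fact q / fact (p + q + 1))) {0..1}"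
    using has_integral_Beta_real[of "real p + 1" "real q + 1"] by simp
  then show ?thesis
    \<comment> \<open>The endpoints are discarded because \<open>0 powr 0 = 0\<close> while
      \<open>0 ^ 0 = 1\<close>.\<close>
    by (rule has_integral_spike_finite[where S = "{0, 1}", rotated 2]) (auto simp: powr_realpow)
qed

lemma integral_sums:
  fixes f :: "nat \<Rightarrow> real \<Rightarrow> 'a :: banach"
  assumes cont: "\<And>k. continuous_on {a..b} (f k)"
    and bound: "\<And>k u. u \<in> {a..b} \<Longrightarrow> norm (f k u) \<le> M k" and "summable M"
    and sums: "\<And>u. u \<in> {a..b} \<Longrightarrow> (\<lambda>k. f k u) sums g u"
  shows "(\<lambda>k. integral {a..b} (f k)) sums integral {a..b} g"
proof -
  have "uniform_limit {a..b} (\<lambda>n u. \<Sum>k<n. f k u) (\<lambda>u. \<Sum>k. f k u) sequentially"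
    by (intro Weierstrass_m_test[OF _ \<open>summable M\<close>]) (use bound in auto)
  then have lim: "uniform_limit {a..b} (\<lambda>n u. \<Sum>k<n. f k u) g sequentially"
    by (rule uniform_limit_cong'[THEN iffD1, rotated 2]) (use sums in \<open>auto simp: sums_iff\<close>)
  obtain I J where I: "\<And>n. ((\<lambda>u. \<Sum>k<n. f k u) has_integral I n) {a..b}"
    and J: "(g has_integral J) {a..b}" and IJ: "I \<longlonglongrightarrow> J"
    by (rule uniform_limit_integral[OF lim]) (auto intro!: continuous_intros cont)
  have "I = (\<lambda>n. \<Sum>k<n. integral {a..b} (f k))"
    by (intro ext has_integral_unique[OF I] has_integral_sum integrable_integral integrable_continuous_interval cont) auto
  moreover have "integral {a..b} g = J" using J by (rule integral_unique)
  ultimately show ?thesis using IJ by (simp add: sums_def)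
qed

text \<open>Euler's integral for the parameters \<open>m + 1\<close>, \<open>m + 1\<close>,
  \<open>2 * m + 2\<close>, without its normalising constant, the reciprocal Beta value
  \<open>fact (2 * m + 1) / (fact m)\<^sup>2\<close>.\<close>

definition euler_integral :: "nat \<Rightarrow> complex \<Rightarrow> complex" where
  "euler_integral m z = integral {0..1} (\<lambda>u. of_real ((u * (1 - u)) ^ m) / (1 - z * of_real u) ^ (m + 1))"

lemma one_minus_mult_nonzero:
  assumes "z \<in> - complex_of_real ` {1..}" "u \<in> {0..1}"
  shows "1 - z * of_real u \<noteq> 0"
proof
  assume "1 - z * of_real u = 0"
  then have eq: "z * of_real u = 1" by simp
  then have "u \<noteq> 0" by auto
  then have "z = of_real (1 / u)" using eq by (simp add: field_simps)
  moreover have "1 / u \<in> {1..}" using assms(2) \<open>u \<noteq> 0\<close> by (auto simp: field_simps)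
  ultimately show False using assms(1) by blast
qed

lemma open_slit_plane: "open (- complex_of_real ` {1..})"
proof -
  have "complex_of_real ` {1..} = \<real> \<inter> {z. Re z \<ge> 1}"
    by (auto simp: complex_is_Real_iff image_iff intro!: exI[of _ "Re _"] complex_eqI)
  then show ?thesis
    using closed_Int[OF closed_complex_Reals closed_halfspace_Re_ge[of 1]] by (metis open_Compl)
qed

text \<open>Differentiation under the integral sign on a ball inside the slit plane: there
  \<open>1 - z * u\<close> has no zero for \<open>u\<close> in the unit interval, so the integrand
  and its \<open>z\<close>-derivative are jointly continuous.\<close>

lemma holomorphic_euler_integral: "euler_integral m holomorphic_on (- complex_of_real ` {1..})"
proof -
  let ?S = "- complex_of_real ` {1..}"
  have "euler_integral m field_differentiable at z" if zS: "z \<in> ?S" for z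
  proof -
    obtain e where e: "e > 0" "ball z e \<subseteq> ?S"
      using open_slit_plane[THEN openE, OF zS] by blast
    let ?f = "\<lambda>z u. of_real ((u * (1 - u)) ^ m) / (1 - z * of_real u) ^ (m + 1) :: complex"
    let ?fx = "\<lambda>z u. of_real ((u * (1 - u)) ^ m) * of_nat (m + 1) * of_real u / (1 - z * of_real u) ^ (m + 2) :: complex"
    have nz: "1 - w * of_real u \<noteq> 0" if "w \<in> ball z e" "u \<in> cbox 0 (1::real)" for w u
      using one_minus_mult_nonzero[of w u] that e by auto
    have "(\<lambda>w. integral (cbox 0 1) (?f w)) holomorphic_on ball z e"
    proof (rule leibniz_rule_holomorphic[where fx = ?fx])
      fix w and u :: real assume w: "w \<in> ball z e" and u: "u \<in> cbox 0 1"
      note n = nz[OF w u]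
      let ?X = "1 - w * of_real u" and ?K = "of_real ((u * (1 - u)) ^ m) :: complex"
      have "((\<lambda>w. (1 - w * of_real u) ^ (m + 1)) has_field_derivative of_nat (m + 1) * (?X ^ m * (- of_real u))) (at w within ball z e)"
      proof -
        have "((\<lambda>w. 1 - w * of_real u) has_field_derivative - of_real u) (at w within ball z e)"
          by (auto intro!: derivative_eq_intros)
        from DERIV_power_Suc[OF this, of m] show ?thesis by (simp add: mult_ac)
      qed
      then have "((\<lambda>w. ?K * inverse ((1 - w * of_real u) ^ (m + 1))) has_field_derivative
          ?K * - (inverse (?X ^ (m + 1)) * (of_nat (m + 1) * (?X ^ m * (- of_real u))) * inverse (?X ^ (m + 1)))) (at w within ball z e)"
        using n by (intro DERIV_cmult DERIV_inverse') auto
      also have "?K * - (inverse (?X ^ (m + 1)) * (of_nat (m + 1) * (?X ^ m * (- of_real u))) * inverse (?X ^ (m + 1))) = ?fx w u"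
      proof -
        have "?K * - (inverse (p * x) * (c * (p * - b)) * inverse (p * x)) = ?K * c * b / (p * x * x)"
          if "p \<noteq> 0" "x \<noteq> 0" for p x b c :: complex
          using that by (simp add: field_simps)
        from this[of "?X ^ m" ?X "of_nat (m + 1)" "of_real u"] n show ?thesis
          by (simp only: power_add power_one_right power2_eq_square mult.assoc) simp
      qed
      finally show "((\<lambda>w. ?f w u) has_field_derivative ?fx w u) (at w within ball z e)"
        by (simp add: divide_inverse)
    next
      fix w assume "w \<in> ball z e"
      then show "?f w integrable_on cbox 0 1"
        using nz by (intro integrable_continuous continuous_intros) auto
    next
      show "continuous_on (ball z e \<times> cbox 0 1) (\<lambda>(w, u). ?fx w u)"
        unfolding case_prod_unfold using nz by (intro continuous_intros) auto
    qed auto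
    then have "euler_integral m holomorphic_on ball z e"
      by (simp add: euler_integral_def[abs_def])
    then show ?thesis using e holomorphic_on_imp_differentiable_at by (metis centre_in_ball open_ball)
  qed
  then show ?thesis by (simp add: holomorphic_on_def field_differentiable_at_within)
qed

text \<open>This is the binomial series with exponent \<open>- (m + 1)\<close>; the sign in the
  generalised binomial coefficient cancels against the sign of \<open>(- z) ^ k\<close>.\<close>

lemma sums_inverse_power:
  fixes z :: complex
  assumes "norm z < 1"
  shows "(\<lambda>k. pochhammer (of_nat (m + 1)) k / fact k * z ^ k) sums (1 / (1 - z) ^ (m + 1))"
proof -
  have nz: "1 - z \<noteq> 0" using assms by auto
  have "(\<lambda>k. (- of_nat (m + 1) gchoose k) * (- z) ^ k) sums (1 + - z) powr (- of_nat (m + 1))"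
    by (rule gen_binomial_complex) (use assms in simp)
  moreover have "(1 + - z) powr (- of_nat (m + 1)) = 1 / (1 - z) ^ (m + 1)"
    using nz powr_nat[of "1 - z" "m + 1"] by (simp add: powr_minus divide_inverse del: of_nat_Suc of_nat_add)
  moreover have "(- of_nat (m + 1) gchoose k) * (- z) ^ k = pochhammer (of_nat (m + 1)) k / fact k * z ^ k" for k
  proof -
    have "(- 1) ^ k * (- z) ^ k = z ^ k" unfolding power_mult_distrib[symmetric] by simp
    then have "(- 1) ^ k * p / q * (- z) ^ k = p / q * z ^ k" for p q :: complex by (simp add: field_simps)
    then show ?thesis unfolding gbinomial_pochhammer minus_minus by blast
  qed
  ultimately show ?thesis by simp
qed

text \<open>Expanding the kernel in powers of \<open>z * u\<close> leaves Beta integrals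
  \<open>(m + k)! m! / (2 m + k + 1)!\<close>. Splitting off \<open>m!\<close> and
  \<open>(2 m + 1)!\<close> turns the remaining factorials into the Pochhammer symbols of the
  hypergeometric series.\<close>

lemma euler_integral_sums:
  assumes z: "norm z < 1"
  shows "(\<lambda>k. pochhammer (of_nat (m + 1)) k * pochhammer (of_nat (m + 1)) k / pochhammer (of_nat (2 * m + 2)) k * (z ^ k / fact k))
    sums (fact (2 * m + 1) / (fact m)\<^sup>2 * euler_integral m z)"
proof -
  let ?p = "\<lambda>k. pochhammer (of_nat (m + 1)) k :: complex"
  let ?f = "\<lambda>k u. ?p k / fact k * z ^ k * of_real (u ^ (m + k) * (1 - u) ^ m) :: complex"
  have "(\<lambda>k. integral {0..1} (?f k)) sums euler_integral m z"
    unfolding euler_integral_def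
  proof (rule integral_sums)
    show "norm (?f k u) \<le> norm (?p k / fact k * of_real (norm z) ^ k)" if "u \<in> {0..1}" for k u
    proof -
      have "\<bar>u ^ (m + k) * (1 - u) ^ m\<bar> \<le> 1"
        using that by (auto simp: abs_mult power_abs intro!: mult_le_one power_le_one)
      then have "norm (?p k / fact k * z ^ k) * \<bar>u ^ (m + k) * (1 - u) ^ m\<bar> \<le> norm (?p k / fact k * z ^ k) * 1"
        by (intro mult_left_mono) auto
      moreover have "norm (?p k / fact k * z ^ k) = norm (?p k / fact k * of_real (norm z) ^ k)"
        by (simp add: norm_mult norm_power norm_divide)
      ultimately show ?thesis by (simp only: norm_mult[of _ "of_real _"] norm_of_real mult_1_right)
    qed
    have "of_real r = pochhammer (of_nat (m + 1)) k / (fact k :: complex) * of_real (norm z) ^ k \<Longrightarrow> norm (?p k / fact k * of_real (norm z) ^ k) = \<bar>r\<bar>" for r k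
      by (metis norm_of_real)
    moreover have H: "of_real (pochhammer (of_nat (m + 1)) k / fact k * norm z ^ k) = pochhammer (of_nat (m + 1)) k / (fact k :: complex) * of_real (norm z) ^ k" for k
      by (simp add: pochhammer_of_real[symmetric])
    ultimately have eq: "norm (?p k / fact k * of_real (norm z) ^ k) = \<bar>pochhammer (of_nat (m + 1)) k / fact k * norm z ^ k\<bar>" for k
      by blast
    also have "\<bar>pochhammer (of_nat (m + 1)) k / fact k * norm z ^ k\<bar> = pochhammer (of_nat (m + 1)) k / fact k * norm z ^ k" for k
      by (simp add: pochhammer_nonneg)
    finally have eq: "norm (?p k / fact k * of_real (norm z) ^ k) = pochhammer (of_nat (m + 1)) k / fact k * norm z ^ k" for k .
    \<comment> \<open>The majorant is the same series at the point \<open>norm z\<close>. Its terms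
      are nonnegative reals, so they equal their norms, and plain convergence there gives
      summability of the norms.\<close>
    have "summable (\<lambda>k. ?p k / fact k * of_real (norm z) ^ k)"
      using sums_inverse_power[of "of_real (norm z)" m] z by (auto simp: sums_iff)
    then have "summable (\<lambda>k. Re (?p k / fact k * of_real (norm z) ^ k))"
      by (rule summable_Re)
    moreover have "Re (?p k / fact k * of_real (norm z) ^ k) = norm (?p k / fact k * of_real (norm z) ^ k)" for k
      by (simp only: eq) (simp only: H[symmetric] Re_complex_of_real)
    ultimately show "summable (\<lambda>k. norm (?p k / fact k * of_real (norm z) ^ k))" by (simp only:)
    show "(\<lambda>k. ?f k u) sums (of_real ((u * (1 - u)) ^ m) / (1 - z * of_real u) ^ (m + 1))" if "u \<in> {0..1}" for u
    proof -
      have "norm (z * of_real u) < 1"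
        using that z mult_left_le[of u "norm z"] by (auto simp: norm_mult)
      from sums_mult[OF sums_inverse_power[OF this, of m], of "of_real ((u * (1 - u)) ^ m)"]
      show ?thesis by (simp add: power_mult_distrib power_add mult_ac)
    qed
  qed (intro continuous_intros)
  from sums_mult[OF this, of "fact (2 * m + 1) / (fact m)\<^sup>2"]
  show ?thesis
  proof (rule sums_cong[THEN iffD1, rotated])
    fix k
    have "integral {0..1} (?f k) = ?p k / fact k * z ^ k * of_real (fact (m + k) * fact m / fact (m + k + m + 1))"
      by (intro integral_unique has_integral_mult_right has_integral_of_real has_integral_Beta_nat)
    moreover have "fact (m + k) = (fact m * ?p k :: complex)"
      using fact_add_pochhammer[of m k] by simp
    moreover have "fact (m + k + m + 1) = (fact (2 * m + 1) * pochhammer (of_nat (2 * m + 2)) k :: complex)"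
    proof -
      have "m + k + m + 1 = 2 * m + 1 + k" "2 * m + 2 = Suc (2 * m + 1)" by simp_all
      then show ?thesis by (simp only: fact_add_pochhammer)
    qed
    ultimately show "fact (2 * m + 1) / (fact m)\<^sup>2 * integral {0..1} (?f k) =
      ?p k * ?p k / pochhammer (of_nat (2 * m + 2)) k * (z ^ k / fact k)"
      by (simp only: of_real_divide of_real_mult of_real_fact) (simp add: power2_eq_square mult_ac del: fact_Suc)
  qed
qed

text \<open>The slit plane is star-shaped about 0: if \<open>u * z = r \<ge> 1\<close> with
  \<open>u\<close> in the unit interval, then \<open>u / r\<close> is in it too and \<open>z\<close>
  is its reciprocal, hence on the cut.\<close>

lemma connected_slit_plane: "connected (- complex_of_real ` {1..})"
proof (rule starlike_imp_connected)
  show "starlike (- complex_of_real ` {1..})"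
    unfolding starlike_def
  proof (intro bexI[of _ 0] ballI subsetI)
    fix z w assume z: "z \<in> - complex_of_real ` {1..}" and "w \<in> closed_segment 0 z"
    then obtain u where u: "u \<in> {0..1}" "w = u *\<^sub>R z" by (auto simp: closed_segment_def)
    show "w \<in> - complex_of_real ` {1..}"
    proof
      assume "w \<in> complex_of_real ` {1..}"
      then obtain r where r: "r \<ge> 1" "w = of_real r" by auto
      then have "1 - z * of_real (u / r) = 0" using u by (auto simp: scaleR_conv_of_real field_simps)
      moreover have "u / r \<in> {0..1}" using u r by auto
      ultimately show False using one_minus_mult_nonzero[OF z] by blast
    qed
  qed auto
qed

text \<open>The Euler integral witnesses that the choice in \<open>hypergeo_2F1\<close> is not
  vacuous. The chosen function then has the same power series on the unit disc, and the identity
  theorem carries the equality over the connected slit plane.\<close>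

lemma hypergeo_2F1_eq_euler_integral:
  assumes z: "z \<in> - complex_of_real ` {1..}"
  shows "hypergeo_2F1 (of_nat (m + 1)) (of_nat (m + 1)) (of_nat (2 * m + 2)) z = fact (2 * m + 1) / (fact m)\<^sup>2 * euler_integral m z"
proof -
  let ?G = "\<lambda>z. fact (2 * m + 1) / (fact m)\<^sup>2 * euler_integral m z"
  let ?P = "\<lambda>F. F holomorphic_on (- complex_of_real ` {1..}) \<and>
     (\<forall>z. norm z < 1 \<longrightarrow>
        (\<lambda>k. pochhammer (of_nat (m + 1)) k * pochhammer (of_nat (m + 1)) k / pochhammer (of_nat (2 * m + 2)) k * (z ^ k / fact k)) sums F z)"
  have "?P ?G"
    using euler_integral_sums holomorphic_euler_integral by (auto intro!: holomorphic_intros)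
  then have P: "?P (SOME F. ?P F)" by (rule someI[where P = ?P])
  have "(SOME F. ?P F) z = ?G z"
  proof (rule analytic_continuation_open[OF _ open_slit_plane _ connected_slit_plane _ _ _ _ z])
    show "ball 0 1 \<subseteq> - complex_of_real ` {1..}" by auto
    show "(SOME F. ?P F) holomorphic_on - complex_of_real ` {1..}" using P by blast
    show "?G holomorphic_on - complex_of_real ` {1..}" using \<open>?P ?G\<close> by blast
    fix w :: complex assume "w \<in> ball 0 1"
    then have "norm w < 1" by simp
    then show "(SOME F. ?P F) w = ?G w" using P \<open>?P ?G\<close> sums_unique2 by blast
  qed auto
  then show ?thesis unfolding hypergeo_2F1_def .
qed

subsection \<open>Termwise integration\<close>

lemma has_sum_exp_exp:
  fixes u v :: real
  shows "((\<lambda>(i, j). u ^ i / fact i * (v ^ j / fact j)) has_sum (exp u * exp v)) UNIV"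
proof -
  have exp_sums: "(\<lambda>i. x ^ i / fact i) sums exp x" for x :: real
    using exp_converges[of x] by (simp add: divide_inverse mult.commute)
  have exp_sum: "((\<lambda>i. x ^ i / fact i) has_sum exp x) UNIV" for x :: real
    using summable_norm_exp[of x] exp_sums
    by (intro norm_summable_imp_has_sum) (simp_all add: divide_inverse mult.commute)
  have inner: "((\<lambda>j. case (i, j) of (i, j) \<Rightarrow> x ^ i / fact i * (y ^ j / fact j)) has_sum (x ^ i / fact i * exp y)) UNIV" for x y :: real and i
    using has_sum_cmult_right[OF exp_sum[of y], of "x ^ i / fact i"] by simp
  have outer: "((\<lambda>i. x ^ i / fact i * exp y) has_sum (exp x * exp y)) UNIV" for x y :: real
    by (rule has_sum_cmult_left[OF exp_sum])
  have "(\<lambda>(i, j). \<bar>u\<bar> ^ i / fact i * (\<bar>v\<bar> ^ j / fact j)) summable_on Sigma UNIV (\<lambda>_. UNIV)"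
    by (rule summable_on_SigmaI[OF inner]) (use outer in \<open>auto simp: summable_on_def\<close>)
  moreover have "(\<lambda>(i, j). \<bar>u\<bar> ^ i / fact i * (\<bar>v\<bar> ^ j / fact j)) = (\<lambda>x. norm (case x of (i, j) \<Rightarrow> u ^ i / fact i * (v ^ j / fact j)))"
    by (auto simp: fun_eq_iff abs_mult power_abs)
  ultimately have "(\<lambda>x. norm (case x of (i, j) \<Rightarrow> u ^ i / fact i * (v ^ j / fact j))) summable_on Sigma UNIV (\<lambda>_. UNIV)"
    by simp
  then have "(\<lambda>(i, j). u ^ i / fact i * (v ^ j / fact j)) summable_on Sigma UNIV (\<lambda>_. UNIV)"
    by (rule abs_summable_summable)
  from has_sum_SigmaI[OF inner outer this] show ?thesis by simp
qed

text \<open>Enumerating the pairs gives a simple series, the form in which termwise integration is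
  applied; absolute convergence makes the enumeration harmless.\<close>

lemma sums_exp_exp_decode:
  fixes u v :: real
  shows "(\<lambda>k. case prod_decode k of (i, j) \<Rightarrow> u ^ i / fact i * (v ^ j / fact j)) sums (exp u * exp v)"
proof (rule has_sum_imp_sums)
  have "bij_betw prod_decode UNIV UNIV" by (rule bij_prod_decode)
  from has_sum_reindex_bij_betw[OF this, of "\<lambda>(i, j). u ^ i / fact i * (v ^ j / fact j)" "exp u * exp v"]
  show "((\<lambda>k. case prod_decode k of (i, j) \<Rightarrow> u ^ i / fact i * (v ^ j / fact j)) has_sum (exp u * exp v)) UNIV"
    using has_sum_exp_exp[of u v] by simp
qed

lemma integrable_exp_abs:
  fixes d :: real
  assumes "d > 0"
  shows "integrable lborel (\<lambda>w::real. exp (- (d * \<bar>w\<bar>)))"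
proof (rule integrableI_nonneg)
  have "(\<integral>\<^sup>+w. ennreal (exp (- (d * \<bar>w\<bar>))) \<partial>lborel) = 2 * (\<integral>\<^sup>+w. ennreal (exp (- (d * \<bar>w\<bar>))) * indicator {0<..} w \<partial>lborel)"
    by (rule nn_integral_even) auto
  also have "(\<integral>\<^sup>+w. ennreal (exp (- (d * \<bar>w\<bar>))) * indicator {0<..} w \<partial>lborel) = (\<integral>\<^sup>+t. ennreal (exp t ^ (0 + 1) * exp (- d * exp t)) \<partial>lborel)"
    by (subst nn_integral_exp_substitution) (auto simp: mult.commute)
  also have "\<dots> = ennreal (1 / d)"
    using nn_integral_gamma_exp[OF assms, of 0] by simp
  also have "2 * ennreal (1 / d) < \<infinity>"
    by (simp add: ennreal_mult_less_top)
  finally show "(\<integral>\<^sup>+w. ennreal (exp (- (d * \<bar>w\<bar>))) \<partial>lborel) < \<infinity>" .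
qed auto

text \<open>What is left of the integrand of the ratio density after the constants and the two
  exponential factors are split off. It is even in \<open>w\<close>, which is why only even powers
  contribute.\<close>

definition K0_weight :: "real \<Rightarrow> real \<Rightarrow> real \<Rightarrow> real" where
  "K0_weight a b w = \<bar>w\<bar> * bessel_K0 (a * \<bar>w\<bar>) * bessel_K0 (b * \<bar>w\<bar>)"

lemma borel_measurable_K0_weight [measurable]: "K0_weight a b \<in> borel_measurable borel"
  unfolding K0_weight_def[abs_def] by measurable

lemma K0_weight_nonneg: "0 \<le> K0_weight a b w"
  by (simp add: K0_weight_def bessel_K0_nonneg)

text \<open>The bounds for the two Bessel factors are singular like
  \<open>1 / sqrt \<bar>w\<bar>\<close> each; the factor \<open>\<bar>w\<bar>\<close> cancels their
  product, and a pure exponential remains. At \<open>w = 0\<close> the weight is 0 because of that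
  factor.\<close>

lemma K0_weight_le:
  assumes a: "a > 0" and b: "b > 0"
  shows "K0_weight a b w \<le> pi / (2 * sqrt (a * b)) * exp (- ((a + b) * \<bar>w\<bar>))"
proof (cases "w = 0")
  case False
  then have w: "\<bar>w\<bar> > 0" by simp
  have "bessel_K0 (a * \<bar>w\<bar>) * bessel_K0 (b * \<bar>w\<bar>)
    \<le> (sqrt (pi / (2 * (a * \<bar>w\<bar>))) * exp (- (a * \<bar>w\<bar>))) * (sqrt (pi / (2 * (b * \<bar>w\<bar>))) * exp (- (b * \<bar>w\<bar>)))"
    using a b w by (intro mult_mono bessel_K0_le) (auto simp: bessel_K0_nonneg)
  also have "\<dots> = sqrt (pi / (2 * (a * \<bar>w\<bar>)) * (pi / (2 * (b * \<bar>w\<bar>)))) * exp (- ((a + b) * \<bar>w\<bar>))"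
  proof -
    have "exp (- (a * \<bar>w\<bar>)) * exp (- (b * \<bar>w\<bar>)) = exp (- ((a + b) * \<bar>w\<bar>))"
      by (simp add: ring_distribs flip: exp_add)
    from this[symmetric] show ?thesis unfolding real_sqrt_mult by (simp only: mult_ac)
  qed
  also have "pi / (2 * (a * \<bar>w\<bar>)) * (pi / (2 * (b * \<bar>w\<bar>))) = (pi / (2 * \<bar>w\<bar>))\<^sup>2 / (a * b)"
    using a b w by (simp add: field_simps power2_eq_square)
  also have "sqrt \<dots> = pi / (2 * \<bar>w\<bar>) / sqrt (a * b)"
    using w by (simp add: real_sqrt_divide)
  finally have "\<bar>w\<bar> * (bessel_K0 (a * \<bar>w\<bar>) * bessel_K0 (b * \<bar>w\<bar>)) \<le> \<bar>w\<bar> * (pi / (2 * \<bar>w\<bar>) / sqrt (a * b) * exp (- ((a + b) * \<bar>w\<bar>)))"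
    by (intro mult_left_mono) auto
  also have "\<dots> = pi / (2 * sqrt (a * b)) * exp (- ((a + b) * \<bar>w\<bar>))"
    using w by simp
  finally show ?thesis by (simp add: K0_weight_def mult.assoc)
qed (use a b in \<open>simp add: K0_weight_def\<close>)

lemma integrable_exp_K0_weight:
  assumes a: "a > 0" and b: "b > 0" and c: "c < a + b"
  shows "integrable lborel (\<lambda>w. exp (c * \<bar>w\<bar>) * K0_weight a b w)"
proof (rule Bochner_Integration.integrable_bound)
  show "integrable lborel (\<lambda>w. pi / (2 * sqrt (a * b)) * exp (- ((a + b - c) * \<bar>w\<bar>)))"
    using c by (intro integrable_mult_right integrable_exp_abs) auto
  show "AE w in lborel. norm (exp (c * \<bar>w\<bar>) * K0_weight a b w) \<le> norm (pi / (2 * sqrt (a * b)) * exp (- ((a + b - c) * \<bar>w\<bar>)))"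
  proof (intro always_eventually allI)
    fix w
    have "exp (c * \<bar>w\<bar>) * K0_weight a b w \<le> exp (c * \<bar>w\<bar>) * (pi / (2 * sqrt (a * b)) * exp (- ((a + b) * \<bar>w\<bar>)))"
      by (intro mult_left_mono K0_weight_le a b) auto
    also have "\<dots> = pi / (2 * sqrt (a * b)) * (exp (c * \<bar>w\<bar>) * exp (- ((a + b) * \<bar>w\<bar>)))"
      by simp
    also have "exp (c * \<bar>w\<bar>) * exp (- ((a + b) * \<bar>w\<bar>)) = exp (- ((a + b - c) * \<bar>w\<bar>))"
      unfolding exp_add[symmetric] by (simp add: algebra_simps)
    finally show "norm (exp (c * \<bar>w\<bar>) * K0_weight a b w) \<le> norm (pi / (2 * sqrt (a * b)) * exp (- ((a + b - c) * \<bar>w\<bar>)))"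
      using a b by (simp add: K0_weight_nonneg abs_mult)
  qed
qed measurable

text \<open>Every finite sum of absolute terms is at most \<open>exp ((\<bar>x\<bar> +
  \<bar>y\<bar>) * \<bar>w\<bar>) * K0_weight a b w\<close>, which is integrable when the growth
  rate stays below \<open>a + b\<close>. Hence the integrals of the absolute terms have bounded
  partial sums, and summation and integration commute.\<close>

lemma has_sum_exp_K0_weight:
  assumes a: "a > 0" and b: "b > 0" and xy: "\<bar>x\<bar> + \<bar>y\<bar> < a + b"
  shows "((\<lambda>(i, j). x ^ i / fact i * (y ^ j / fact j) * (\<integral>w. w ^ (i + j) * K0_weight a b w \<partial>lborel))
    has_sum (\<integral>w. exp (x * w) * exp (y * w) * K0_weight a b w \<partial>lborel)) UNIV"
proof -
  define g where "g u v k = (case prod_decode k of (i, j) \<Rightarrow> u ^ i / fact i * (v ^ j / fact j))" for u v :: real and k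
  have g_sums: "g u v sums (exp u * exp v)" for u v
    unfolding g_def[abs_def] by (rule sums_exp_exp_decode)
  have g_abs: "\<bar>g u v k\<bar> = g \<bar>u\<bar> \<bar>v\<bar> k" for u v k
    by (auto simp: g_def abs_mult power_abs split: prod.splits)
  have g_nonneg: "g \<bar>u\<bar> \<bar>v\<bar> k \<ge> 0" for u v k
    using g_abs[of u v k] by linarith
  have [measurable]: "(\<lambda>w. g (x * w) (y * w) k) \<in> borel_measurable borel" for x y k
    unfolding g_def by (cases "prod_decode k") simp
  define f where "f k w = g (x * w) (y * w) k * K0_weight a b w" for k w
  define B where "B w = exp ((\<bar>x\<bar> + \<bar>y\<bar>) * \<bar>w\<bar>) * K0_weight a b w" for w
  have B: "integrable lborel B"
    unfolding B_def[abs_def] by (rule integrable_exp_K0_weight[OF a b xy])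
  have bound: "(\<Sum>k\<in>A. norm (f k w)) \<le> B w" if "finite A" for A w
  proof -
    have "(\<Sum>k\<in>A. norm (f k w)) = (\<Sum>k\<in>A. g \<bar>x * w\<bar> \<bar>y * w\<bar> k) * K0_weight a b w"
      by (simp add: f_def abs_mult g_abs K0_weight_nonneg sum_distrib_right)
    also have "\<dots> \<le> (exp \<bar>x * w\<bar> * exp \<bar>y * w\<bar>) * K0_weight a b w"
      using sum_le_suminf[OF sums_summable[OF g_sums] that, of "\<bar>x * w\<bar>" "\<bar>y * w\<bar>"] g_nonneg
      by (intro mult_right_mono K0_weight_nonneg) (simp add: sums_unique[OF g_sums, symmetric])
    also have "\<dots> = B w"
      by (simp add: B_def exp_add ring_distribs abs_mult)
    finally show ?thesis .
  qed
  have int: "integrable lborel (f k)" for k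
  proof (rule Bochner_Integration.integrable_bound[OF B])
    show "f k \<in> borel_measurable lborel" unfolding f_def[abs_def] by measurable
    show "AE w in lborel. norm (f k w) \<le> norm (B w)"
      using order_trans[OF bound[of "{k}"] abs_ge_self] by (intro always_eventually allI) simp
  qed
  have summ: "summable (\<lambda>k. \<integral>w. norm (f k w) \<partial>lborel)"
  proof (rule summableI_nonneg_bounded)
    show "(\<Sum>k<n. \<integral>w. norm (f k w) \<partial>lborel) \<le> (\<integral>w. B w \<partial>lborel)" for n
    proof -
      have "(\<Sum>k<n. \<integral>w. norm (f k w) \<partial>lborel) = (\<integral>w. (\<Sum>k<n. norm (f k w)) \<partial>lborel)"
        by (rule Bochner_Integration.integral_sum[symmetric]) (use int in auto)
      also have "\<dots> \<le> (\<integral>w. B w \<partial>lborel)"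
        using int B bound by (intro integral_mono Bochner_Integration.integrable_sum) auto
      finally show ?thesis .
    qed
  qed auto
  have f_sums: "(\<lambda>k. f k w) sums (exp (x * w) * exp (y * w) * K0_weight a b w)" for w
    unfolding f_def by (intro sums_mult2 g_sums)
  have "(\<lambda>k. \<integral>w. f k w \<partial>lborel) sums (\<integral>w. (\<Sum>k. f k w) \<partial>lborel)"
  proof (rule sums_integral[OF int _ summ])
    show "AE w in lborel. summable (\<lambda>k. norm (f k w))"
      using bound by (intro always_eventually allI summableI_nonneg_bounded) auto
  qed
  also have "(\<lambda>w. \<Sum>k. f k w) = (\<lambda>w. exp (x * w) * exp (y * w) * K0_weight a b w)"
    using f_sums by (auto simp: sums_iff)
  finally have sums: "(\<lambda>k. \<integral>w. f k w \<partial>lborel) sums (\<integral>w. exp (x * w) * exp (y * w) * K0_weight a b w \<partial>lborel)" .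
  \<comment> \<open>Absolute summability of the integrals upgrades the ordered series to an
    unordered sum, so the enumeration of pairs can be undone.\<close>
  have "summable (\<lambda>k. norm (\<integral>w. f k w \<partial>lborel))"
    by (rule summable_comparison_test'[OF summ]) (auto intro: integral_norm_bound)
  from norm_summable_imp_has_sum[OF this sums]
  have "((\<lambda>k. \<integral>w. f k w \<partial>lborel) has_sum (\<integral>w. exp (x * w) * exp (y * w) * K0_weight a b w \<partial>lborel)) UNIV" .
  also have "(\<lambda>k. \<integral>w. f k w \<partial>lborel) = (\<lambda>k. (\<lambda>(i, j). x ^ i / fact i * (y ^ j / fact j) * (\<integral>w. w ^ (i + j) * K0_weight a b w \<partial>lborel)) (prod_decode k))"
  proof
    fix k
    obtain i j where k: "prod_decode k = (i, j)" by (cases "prod_decode k")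
    have "f k = (\<lambda>w. x ^ i / fact i * (y ^ j / fact j) * (w ^ (i + j) * K0_weight a b w))"
      by (auto simp: f_def g_def k power_mult_distrib power_add)
    then show "(\<integral>w. f k w \<partial>lborel) = (\<lambda>(i, j). x ^ i / fact i * (y ^ j / fact j) * (\<integral>w. w ^ (i + j) * K0_weight a b w \<partial>lborel)) (prod_decode k)"
      by (simp add: k)
  qed
  finally show ?thesis
    by (rule has_sum_reindex_bij_betw[OF bij_prod_decode, THEN iffD1])
qed

text \<open>The Euler integral in homogeneous real form: taking \<open>a\<^sup>2\<close> out of the
  denominator leaves \<open>1 - (1 - (b / a)\<^sup>2) * u\<close>.\<close>

definition beta_kernel_integral :: "nat \<Rightarrow> real \<Rightarrow> real \<Rightarrow> real" where
  "beta_kernel_integral m a b = integral {0..1} (\<lambda>u. (u * (1 - u)) ^ m / (a\<^sup>2 * (1 - u) + b\<^sup>2 * u) ^ (m + 1))"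

lemma has_integral_beta_kernel:
  assumes "a > 0" "b > 0"
  shows "((\<lambda>u. (u * (1 - u)) ^ m / (a\<^sup>2 * (1 - u) + b\<^sup>2 * u) ^ (m + 1)) has_integral beta_kernel_integral m a b) {0..1}"
  unfolding beta_kernel_integral_def
proof (intro integrable_integral integrable_continuous_interval continuous_intros ballI)
  fix u :: real assume u: "u \<in> {0..1}"
  show "(a\<^sup>2 * (1 - u) + b\<^sup>2 * u) ^ (m + 1) \<noteq> 0"
  proof (cases "u = 1")
    case False
    then have "a\<^sup>2 * (1 - u) + b\<^sup>2 * u > 0"
      using u assms by (intro add_pos_nonneg mult_pos_pos mult_nonneg_nonneg) auto
    then show ?thesis by simp
  qed (use assms in simp)
qed

text \<open>Evenness doubles the half-line moment and so removes its factor \<open>1 / 2\<close>.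
  The value is a finite real number, which allows the passage from the nonnegative to the Bochner
  integral.\<close>

lemma K0_weight_moment_even:
  assumes a: "a > 0" and b: "b > 0"
  shows "(\<integral>w. w ^ (2 * m) * K0_weight a b w \<partial>lborel) = 4 ^ m * (fact m)\<^sup>2 * beta_kernel_integral m a b"
proof -
  let ?h = "\<lambda>u::real. 4 ^ m * (fact m)\<^sup>2 / 2 * ((u * (1 - u)) ^ m / (a\<^sup>2 * (1 - u) + b\<^sup>2 * u) ^ (m + 1))"
  have nonneg: "?h u \<ge> 0" if "u \<in> {0..1}" for u
    using that by auto
  have int: "(?h has_integral (4 ^ m * (fact m)\<^sup>2 / 2 * beta_kernel_integral m a b)) {0..1}"
    by (intro has_integral_mult_right has_integral_beta_kernel a b)
  have nn: "4 ^ m * (fact m)\<^sup>2 / 2 * beta_kernel_integral m a b \<ge> 0"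
    using has_integral_nonneg[OF int] nonneg by auto
  have "(\<integral>\<^sup>+w. ennreal (w ^ (2 * m) * K0_weight a b w) \<partial>lborel) = 2 * (\<integral>\<^sup>+w. ennreal (w ^ (2 * m) * K0_weight a b w) * indicator {0<..} w \<partial>lborel)"
    by (rule nn_integral_even) (auto simp: K0_weight_def)
  also have "(\<integral>\<^sup>+w. ennreal (w ^ (2 * m) * K0_weight a b w) * indicator {0<..} w \<partial>lborel)
    = (\<integral>\<^sup>+w. ennreal (w ^ (2 * m + 1) * bessel_K0 (a * w) * bessel_K0 (b * w)) * indicator {0<..} w \<partial>lborel)"
    by (intro nn_integral_cong) (auto simp: indicator_def K0_weight_def mult_ac)
  also have "\<dots> = (\<integral>\<^sup>+u. ennreal (?h u) * indicator {0<..<1} u \<partial>lborel)"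
    by (rule nn_integral_moment_bessel_K0[OF a b])
  also have "\<dots> = (\<integral>\<^sup>+u. ennreal (?h u) * indicator {0..1} u \<partial>lborel)"
    by (intro nn_integral_cong_AE, rule AE_mp[OF AE_lborel_singleton[of 0]], rule AE_mp[OF AE_lborel_singleton[of 1]])
       (auto simp: indicator_def)
  also have "\<dots> = ennreal (4 ^ m * (fact m)\<^sup>2 / 2 * beta_kernel_integral m a b)"
    by (rule nn_integral_has_integral_lebesgue'[OF nonneg int])
  also have "2 * \<dots> = ennreal (4 ^ m * (fact m)\<^sup>2 * beta_kernel_integral m a b)"
    using ennreal_mult'[of 2 "4 ^ m * (fact m)\<^sup>2 / 2 * beta_kernel_integral m a b"] by simp
  finally have eq: "(\<integral>\<^sup>+w. ennreal (w ^ (2 * m) * K0_weight a b w) \<partial>lborel) = \<dots>" .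
  have "(\<integral>w. w ^ (2 * m) * K0_weight a b w \<partial>lborel) = enn2real (\<integral>\<^sup>+w. ennreal (w ^ (2 * m) * K0_weight a b w) \<partial>lborel)"
    by (intro integral_eq_nn_integral) (auto simp: K0_weight_nonneg)
  then show ?thesis unfolding eq using nn by simp
qed

text \<open>Reflection turns the integral into its own negative. These are the terms with
  \<open>even_ind i j = 0\<close>.\<close>

lemma K0_weight_moment_odd:
  assumes "odd n"
  shows "(\<integral>w. w ^ n * K0_weight a b w \<partial>lborel) = 0"
proof -
  have "(\<integral>w. w ^ n * K0_weight a b w \<partial>lborel) = (\<integral>w. (0 + -1 * w) ^ n * K0_weight a b (0 + -1 * w) \<partial>lborel)"
    by (subst lborel_integral_real_affine[of "-1" _ 0]) auto
  also have "\<dots> = (\<integral>w. - (w ^ n * K0_weight a b w) \<partial>lborel)"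
    using assms by (intro Bochner_Integration.integral_cong) (auto simp: K0_weight_def)
  also have "\<dots> = - (\<integral>w. w ^ n * K0_weight a b w \<partial>lborel)" by simp
  finally show ?thesis by simp
qed

text \<open>The argument is below 1, hence off the cut, for all positive \<open>a\<close> and
  \<open>b\<close>; it leaves the open unit disc as soon as \<open>(b / a)\<^sup>2 \<ge> 2\<close>,
  where the value is one of the continuation.\<close>

lemma hypergeo_2F1_eq_beta_kernel_integral:
  assumes a: "a > 0" and b: "b > 0"
  shows "hypergeo_2F1 (of_nat (m + 1)) (of_nat (m + 1)) (of_nat (2 * m + 2)) (of_real (1 - (b / a)\<^sup>2))
    = of_real (fact (2 * m + 1) / (fact m)\<^sup>2 * (a ^ (2 * m + 2) * beta_kernel_integral m a b))"
proof -
  let ?x = "1 - (b / a)\<^sup>2"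
  have "?x < 1" using a b by simp
  then have x: "of_real ?x \<in> - complex_of_real ` {1..}"
    by (auto simp del: of_real_diff of_real_power of_real_divide)
  have eq: "a ^ (2 * m + 2) * ((u * (1 - u)) ^ m / (a\<^sup>2 * (1 - u) + b\<^sup>2 * u) ^ (m + 1)) = (u * (1 - u)) ^ m / (1 - ?x * u) ^ (m + 1)" for u
  proof -
    have "a\<^sup>2 * (1 - u) + b\<^sup>2 * u = a\<^sup>2 * (1 - ?x * u)"
      using a by (simp add: field_simps power_divide)
    moreover have "a ^ (2 * m + 2) = (a\<^sup>2) ^ (m + 1)" by (simp only: power_mult[symmetric]) simp
    ultimately show ?thesis
      using a by (simp add: power_mult_distrib del: power_Suc)
  qed
  have "((\<lambda>u. (u * (1 - u)) ^ m / (1 - ?x * u) ^ (m + 1)) has_integral (a ^ (2 * m + 2) * beta_kernel_integral m a b)) {0..1}"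
    using has_integral_mult_right[OF has_integral_beta_kernel[OF a b, of m], of "a ^ (2 * m + 2)"] unfolding eq .
  from has_integral_of_real[OF this, where 'b = complex]
  have "euler_integral m (of_real ?x) = of_real (a ^ (2 * m + 2) * beta_kernel_integral m a b)"
    unfolding euler_integral_def by (intro integral_unique) (simp del: power_Suc)
  then show ?thesis
    unfolding hypergeo_2F1_eq_euler_integral[OF x] by simp
qed

subsection \<open>Densities of products and ratios\<close>

lemma borel_measurable_bivariate_normal_density [measurable]:
  "bivariate_normal_density \<mu>u \<mu>v \<sigma>u \<sigma>v \<rho> \<in> borel_measurable (borel \<Otimes>\<^sub>M borel)"
  unfolding bivariate_normal_density_def by measurable

lemma borel_measurable_normal_product_density [measurable]:
  "normal_product_density s \<rho> \<in> borel_measurable borel"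
  unfolding normal_product_density_def[abs_def] by measurable

lemma normal_product_density_nonneg:
  assumes "s > 0" "\<rho> \<in> {-1<..<1}"
  shows "0 \<le> normal_product_density s \<rho> w"
proof -
  have "\<rho>\<^sup>2 < 1" using assms(2) by (simp add: abs_square_less_1 abs_less_iff)
  then show ?thesis
    using assms by (simp add: normal_product_density_def bessel_K0_nonneg)
qed

text \<open>On the hyperbola \<open>u * v = w\<close> the cross term is constant and gives the
  exponential factor of the density. The rest of the exponent is a combination of
  \<open>u\<^sup>2\<close> and \<open>1 / u\<^sup>2\<close>, and \<open>u = exp t\<close> makes it a
  Bessel integral; \<open>w \<noteq> 0\<close> keeps the second coefficient positive.\<close>

lemma nn_integral_bivariate_normal_hyperbola:
  assumes \<sigma>: "\<sigma>u > 0" "\<sigma>v > 0" and \<rho>: "\<rho> \<in> {-1<..<1}" and w: "w \<noteq> 0"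
  shows "(\<integral>\<^sup>+u. ennreal (\<bar>1 / u\<bar> * bivariate_normal_density 0 0 \<sigma>u \<sigma>v \<rho> (u, 1 / u * w)) \<partial>lborel)
    = ennreal (normal_product_density (\<sigma>u * \<sigma>v) \<rho> w)"
proof -
  have q: "1 - \<rho>\<^sup>2 > 0" using \<rho> by (simp add: abs_square_less_1 abs_less_iff)
  let ?A = "1 / (2 * \<sigma>u\<^sup>2 * (1 - \<rho>\<^sup>2))" and ?B = "w\<^sup>2 / (2 * \<sigma>v\<^sup>2 * (1 - \<rho>\<^sup>2))"
  let ?C = "1 / (2 * pi * \<sigma>u * \<sigma>v * sqrt (1 - \<rho>\<^sup>2)) * exp (\<rho> * w / (\<sigma>u * \<sigma>v * (1 - \<rho>\<^sup>2)))"
  have A: "?A > 0" using \<sigma> q by simp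
  have B: "?B > 0" using \<sigma> q w by simp
  have C: "?C \<ge> 0" using \<sigma> q by simp
  have density: "bivariate_normal_density 0 0 \<sigma>u \<sigma>v \<rho> (u, 1 / u * w) = ?C * exp (- (?A * u\<^sup>2 + ?B * (1 / u)\<^sup>2))" if "u \<noteq> 0" for u
  proof -
    have "- (((u - 0) / \<sigma>u)\<^sup>2 - 2 * \<rho> * ((u - 0) / \<sigma>u) * ((1 / u * w - 0) / \<sigma>v) + ((1 / u * w - 0) / \<sigma>v)\<^sup>2) / (2 * (1 - \<rho>\<^sup>2))
       = \<rho> * w / (\<sigma>u * \<sigma>v * (1 - \<rho>\<^sup>2)) + - (?A * u\<^sup>2 + ?B * (1 / u)\<^sup>2)"
    proof -
      have "- (((u - 0) / \<sigma>u)\<^sup>2 - 2 * \<rho> * ((u - 0) / \<sigma>u) * ((1 / u * w - 0) / \<sigma>v) + ((1 / u * w - 0) / \<sigma>v)\<^sup>2) / (2 * q)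
       = \<rho> * w / (\<sigma>u * \<sigma>v * q) + - (1 / (2 * \<sigma>u\<^sup>2 * q) * u\<^sup>2 + w\<^sup>2 / (2 * \<sigma>v\<^sup>2 * q) * (1 / u)\<^sup>2)" if "q > 0" for q
        using that \<sigma> \<open>u \<noteq> 0\<close> by (simp add: field_simps power2_eq_square)
      from this[OF q] show ?thesis .
    qed
    then show ?thesis
      unfolding bivariate_normal_density_def by (simp only: prod.case exp_add mult.assoc)
  qed
  have "(\<integral>\<^sup>+u. ennreal (\<bar>1 / u\<bar> * bivariate_normal_density 0 0 \<sigma>u \<sigma>v \<rho> (u, 1 / u * w)) \<partial>lborel)
    = (\<integral>\<^sup>+u. ennreal (\<bar>1 / u\<bar> * (?C * exp (- (?A * u\<^sup>2 + ?B * (1 / u)\<^sup>2)))) \<partial>lborel)"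
    by (intro nn_integral_cong_AE, rule AE_mp[OF AE_lborel_singleton[of 0]], intro always_eventually allI impI)
       (simp only: density simp_thms)
  also have "\<dots> = 2 * (\<integral>\<^sup>+u. ennreal (\<bar>1 / u\<bar> * (?C * exp (- (?A * u\<^sup>2 + ?B * (1 / u)\<^sup>2)))) * indicator {0<..} u \<partial>lborel)"
    by (rule nn_integral_even) auto
  also have "(\<integral>\<^sup>+u. ennreal (\<bar>1 / u\<bar> * (?C * exp (- (?A * u\<^sup>2 + ?B * (1 / u)\<^sup>2)))) * indicator {0<..} u \<partial>lborel)
    = (\<integral>\<^sup>+t. ennreal (\<bar>1 / exp t\<bar> * (?C * exp (- (?A * (exp t)\<^sup>2 + ?B * (1 / exp t)\<^sup>2))) * exp t) \<partial>lborel)"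
    by (rule nn_integral_exp_substitution) measurable
  also have "\<dots> = (\<integral>\<^sup>+t. ennreal ?C * ennreal (exp (- (?A * exp (0 + 2 * t) + ?B * exp (- (0 + 2 * t))))) \<partial>lborel)"
  proof (rule nn_integral_cong)
    fix t :: real
    have "(exp t)\<^sup>2 = exp (0 + 2 * t)" "(1 / exp t)\<^sup>2 = exp (- (0 + 2 * t))"
      by (simp_all add: exp_double exp_minus power_divide divide_inverse power_inverse)
    then show "ennreal (\<bar>1 / exp t\<bar> * (?C * exp (- (?A * (exp t)\<^sup>2 + ?B * (1 / exp t)\<^sup>2))) * exp t)
        = ennreal ?C * ennreal (exp (- (?A * exp (0 + 2 * t) + ?B * exp (- (0 + 2 * t)))))"
      using C by (subst ennreal_mult[symmetric]) (simp_all only: exp_ge_zero, simp)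
  qed
  also have "\<dots> = ennreal ?C * (\<integral>\<^sup>+t. ennreal (exp (- (?A * exp (0 + 2 * t) + ?B * exp (- (0 + 2 * t))))) \<partial>lborel)"
    by (rule nn_integral_cmult) measurable
  \<comment> \<open>The factor 2 from evenness is the Jacobian of doubling \<open>t\<close>; the
    summand 0 keeps the argument in the shape of an affine substitution.\<close>
  also have "2 * \<dots> = ennreal ?C * (ennreal \<bar>2\<bar> * (\<integral>\<^sup>+t. ennreal (exp (- (?A * exp (0 + 2 * t) + ?B * exp (- (0 + 2 * t))))) \<partial>lborel))"
    by (simp add: mult_ac)
  also have "ennreal \<bar>2\<bar> * (\<integral>\<^sup>+t. ennreal (exp (- (?A * exp (0 + 2 * t) + ?B * exp (- (0 + 2 * t))))) \<partial>lborel)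
    = (\<integral>\<^sup>+t. ennreal (exp (- (?A * exp t + ?B * exp (- t)))) \<partial>lborel)"
    by (rule nn_integral_real_affine[symmetric]) auto
  also have "\<dots> = ennreal (2 * bessel_K0 (2 * sqrt (?A * ?B)))"
    by (rule nn_integral_exp_exp_minus[OF A B])
  also have "ennreal ?C * \<dots> = ennreal (?C * (2 * bessel_K0 (2 * sqrt (?A * ?B))))"
    using C by (rule ennreal_mult'[symmetric])
  also have "2 * sqrt (?A * ?B) = \<bar>w\<bar> / (\<sigma>u * \<sigma>v * (1 - \<rho>\<^sup>2))"
  proof -
    have "?A * ?B = (\<bar>w\<bar> / (2 * (\<sigma>u * \<sigma>v * (1 - \<rho>\<^sup>2))))\<^sup>2"
      by (simp add: power2_eq_square)
    then have "sqrt (?A * ?B) = \<bar>w\<bar> / (2 * (\<sigma>u * \<sigma>v * (1 - \<rho>\<^sup>2)))"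
      using \<sigma> q by (simp only: real_sqrt_abs) simp
    then show ?thesis by simp
  qed
  finally show ?thesis
    by (simp add: normal_product_density_def mult.assoc)
qed

text \<open>For fixed \<open>u \<noteq> 0\<close> the substitution \<open>v = w / u\<close> and
  Tonelli express the law of the product by integrals over hyperbolas. The exceptional values
  \<open>u = 0\<close> and \<open>w = 0\<close> are null sets.\<close>

lemma distributed_product_bivariate_normal:
  assumes \<sigma>: "\<sigma>u > 0" "\<sigma>v > 0" and \<rho>: "\<rho> \<in> {-1<..<1}"
    and D: "distributed M lborel (\<lambda>\<omega>. (U \<omega>, V \<omega>)) (\<lambda>x. ennreal (bivariate_normal_density 0 0 \<sigma>u \<sigma>v \<rho> x))"
  shows "distributed M lborel (\<lambda>\<omega>. U \<omega> * V \<omega>) (\<lambda>w. ennreal (normal_product_density (\<sigma>u * \<sigma>v) \<rho> w))"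
proof -
  let ?\<phi> = "bivariate_normal_density 0 0 \<sigma>u \<sigma>v \<rho>"
  have [measurable]: "(\<lambda>\<omega>. (U \<omega>, V \<omega>)) \<in> measurable M (borel \<Otimes>\<^sub>M borel)"
    using distributed_measurable[OF D] by (simp add: borel_prod)
  have UV: "(\<lambda>\<omega>. U \<omega> * V \<omega>) \<in> borel_measurable M"
  proof -
    have "(\<lambda>\<omega>. case (U \<omega>, V \<omega>) of (u, v) \<Rightarrow> u * v) \<in> borel_measurable M"
      by measurable
    then show ?thesis by simp
  qed
  have "distr M lborel (\<lambda>\<omega>. U \<omega> * V \<omega>) = density lborel (\<lambda>w. ennreal (normal_product_density (\<sigma>u * \<sigma>v) \<rho> w))"
  proof (rule measure_eqI)
    fix A assume "A \<in> sets (distr M lborel (\<lambda>\<omega>. U \<omega> * V \<omega>))"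
    then have [measurable]: "A \<in> sets borel" by simp
    have "emeasure (distr M lborel (\<lambda>\<omega>. U \<omega> * V \<omega>)) A = (\<integral>\<^sup>+x. indicator A x \<partial>distr M lborel (\<lambda>\<omega>. U \<omega> * V \<omega>))"
      by simp
    also have "\<dots> = (\<integral>\<^sup>+\<omega>. indicator A (U \<omega> * V \<omega>) \<partial>M)"
      using UV by (subst nn_integral_distr) auto
    also have "\<dots> = (\<integral>\<^sup>+\<omega>. (\<lambda>(u, v). indicator A (u * v)) (U \<omega>, V \<omega>) \<partial>M)"
      by simp
    also have "\<dots> = (\<integral>\<^sup>+x. ennreal (?\<phi> x) * (\<lambda>(u, v). indicator A (u * v)) x \<partial>lborel)"
      by (rule distributed_nn_integral[OF D, symmetric]) (simp add: borel_prod[symmetric])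
    also have "\<dots> = (\<integral>\<^sup>+x. ennreal (?\<phi> x) * (\<lambda>(u, v). indicator A (u * v)) x \<partial>(lborel \<Otimes>\<^sub>M lborel))"
      by (simp add: lborel_prod)
    also have "\<dots> = (\<integral>\<^sup>+u. \<integral>\<^sup>+v. ennreal (?\<phi> (u, v)) * indicator A (u * v) \<partial>lborel \<partial>lborel)"
      by (subst lborel.nn_integral_fst[symmetric]) auto
    also have "\<dots> = (\<integral>\<^sup>+u. \<integral>\<^sup>+w. ennreal (\<bar>1 / u\<bar> * ?\<phi> (u, 1 / u * w)) * indicator A w \<partial>lborel \<partial>lborel)"
    proof (intro nn_integral_cong_AE, rule AE_mp[OF AE_lborel_singleton[of 0]], intro always_eventually allI impI)
      fix u :: real assume u: "u \<noteq> 0"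
      have "(\<integral>\<^sup>+v. ennreal (?\<phi> (u, v)) * indicator A (u * v) \<partial>lborel)
        = ennreal \<bar>1 / u\<bar> * (\<integral>\<^sup>+w. ennreal (?\<phi> (u, 0 + 1 / u * w)) * indicator A (u * (0 + 1 / u * w)) \<partial>lborel)"
        using u by (intro nn_integral_real_affine) auto
      also have "\<dots> = (\<integral>\<^sup>+w. ennreal \<bar>1 / u\<bar> * (ennreal (?\<phi> (u, 0 + 1 / u * w)) * indicator A (u * (0 + 1 / u * w))) \<partial>lborel)"
        by (rule nn_integral_cmult[symmetric]) measurable
      also have "\<dots> = (\<integral>\<^sup>+w. ennreal (\<bar>1 / u\<bar> * ?\<phi> (u, 1 / u * w)) * indicator A w \<partial>lborel)"
      proof (rule nn_integral_cong)
        fix w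
        have "0 + 1 / u * w = 1 / u * w" "u * (1 / u * w) = w" using u by simp_all
        then show "ennreal \<bar>1 / u\<bar> * (ennreal (?\<phi> (u, 0 + 1 / u * w)) * indicator A (u * (0 + 1 / u * w)))
            = ennreal (\<bar>1 / u\<bar> * ?\<phi> (u, 1 / u * w)) * indicator A w"
          by (simp only: ennreal_mult'[OF abs_ge_zero] mult.assoc)
      qed
      finally show "(\<integral>\<^sup>+v. ennreal (?\<phi> (u, v)) * indicator A (u * v) \<partial>lborel) = \<dots>" .
    qed
    also have "\<dots> = (\<integral>\<^sup>+w. \<integral>\<^sup>+u. ennreal (\<bar>1 / u\<bar> * ?\<phi> (u, 1 / u * w)) * indicator A w \<partial>lborel \<partial>lborel)"
      by (rule lborel_pair.Fubini') measurable
    also have "\<dots> = (\<integral>\<^sup>+w. (\<integral>\<^sup>+u. ennreal (\<bar>1 / u\<bar> * ?\<phi> (u, 1 / u * w)) \<partial>lborel) * indicator A w \<partial>lborel)"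
      by (intro nn_integral_cong nn_integral_multc) measurable
    also have "\<dots> = (\<integral>\<^sup>+w. ennreal (normal_product_density (\<sigma>u * \<sigma>v) \<rho> w) * indicator A w \<partial>lborel)"
      by (intro nn_integral_cong_AE, rule AE_mp[OF AE_lborel_singleton[of 0]], intro always_eventually allI impI)
         (simp only: nn_integral_bivariate_normal_hyperbola[OF \<sigma> \<rho>] simp_thms)
    also have "\<dots> = emeasure (density lborel (\<lambda>w. ennreal (normal_product_density (\<sigma>u * \<sigma>v) \<rho> w))) A"
      by (subst emeasure_density) auto
    finally show "emeasure (distr M lborel (\<lambda>\<omega>. U \<omega> * V \<omega>)) A = \<dots>" .
  qed simp
  then show ?thesis
    using UV by (simp add: distributed_def)
qed

text \<open>For fixed \<open>w \<noteq> 0\<close> the numerator is written as \<open>w * t\<close>,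
  with Jacobian \<open>\<bar>w\<bar>\<close>. The densities take values in \<open>ennreal\<close>,
  so that finiteness of the resulting integral can be settled afterwards.\<close>

lemma (in prob_space) distributed_ratio_indep:
  fixes X Y :: "'a \<Rightarrow> real" and f g :: "real \<Rightarrow> ennreal"
  assumes X: "distributed M lborel X f" and Y: "distributed M lborel Y g" and ind: "indep_var borel X borel Y"
  shows "distributed M lborel (\<lambda>\<omega>. X \<omega> / Y \<omega>) (\<lambda>t. \<integral>\<^sup>+w. ennreal \<bar>w\<bar> * f (w * t) * g w \<partial>lborel)"
proof -
  have [measurable]: "f \<in> borel_measurable borel" "g \<in> borel_measurable borel"
    "X \<in> borel_measurable M" "Y \<in> borel_measurable M"
    using X Y by (auto simp: distributed_def)
  have "indep_var lborel X lborel Y"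
    using indep_var_compose[OF ind, of "\<lambda>x. x" lborel "\<lambda>x. x" lborel] by (simp add: comp_def)
  then have joint: "distributed M (lborel \<Otimes>\<^sub>M lborel) (\<lambda>\<omega>. (X \<omega>, Y \<omega>)) (\<lambda>(x, y). f x * g y)"
    by (intro distributed_joint_indep X Y sigma_finite_lborel)
  have "distr M lborel (\<lambda>\<omega>. X \<omega> / Y \<omega>) = density lborel (\<lambda>t. \<integral>\<^sup>+w. ennreal \<bar>w\<bar> * f (w * t) * g w \<partial>lborel)"
  proof (rule measure_eqI)
    fix A assume "A \<in> sets (distr M lborel (\<lambda>\<omega>. X \<omega> / Y \<omega>))"
    then have [measurable]: "A \<in> sets borel" by simp
    have "emeasure (distr M lborel (\<lambda>\<omega>. X \<omega> / Y \<omega>)) A = (\<integral>\<^sup>+x. indicator A x \<partial>distr M lborel (\<lambda>\<omega>. X \<omega> / Y \<omega>))"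
      by simp
    also have "\<dots> = (\<integral>\<^sup>+\<omega>. (\<lambda>(x, y). indicator A (x / y)) (X \<omega>, Y \<omega>) \<partial>M)"
      by (subst nn_integral_distr) auto
    also have "\<dots> = (\<integral>\<^sup>+z. (\<lambda>(x, y). f x * g y) z * (\<lambda>(x, y). indicator A (x / y)) z \<partial>(lborel \<Otimes>\<^sub>M lborel))"
      by (rule distributed_nn_integral[OF joint, symmetric]) measurable
    also have "\<dots> = (\<integral>\<^sup>+w. \<integral>\<^sup>+x. f x * g w * indicator A (x / w) \<partial>lborel \<partial>lborel)"
      by (subst lborel_pair.nn_integral_snd[symmetric]) auto
    also have "\<dots> = (\<integral>\<^sup>+w. \<integral>\<^sup>+t. ennreal \<bar>w\<bar> * f (w * t) * g w * indicator A t \<partial>lborel \<partial>lborel)"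
    proof (intro nn_integral_cong_AE, rule AE_mp[OF AE_lborel_singleton[of 0]], intro always_eventually allI impI)
      fix w :: real assume w: "w \<noteq> 0"
      have "(\<integral>\<^sup>+x. f x * g w * indicator A (x / w) \<partial>lborel)
        = ennreal \<bar>w\<bar> * (\<integral>\<^sup>+t. f (0 + w * t) * g w * indicator A ((0 + w * t) / w) \<partial>lborel)"
        using w by (intro nn_integral_real_affine) auto
      also have "\<dots> = (\<integral>\<^sup>+t. ennreal \<bar>w\<bar> * (f (0 + w * t) * g w * indicator A ((0 + w * t) / w)) \<partial>lborel)"
        by (rule nn_integral_cmult[symmetric]) measurable
      also have "\<dots> = (\<integral>\<^sup>+t. ennreal \<bar>w\<bar> * f (w * t) * g w * indicator A t \<partial>lborel)"
        using w by (intro nn_integral_cong) (simp add: mult.assoc)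
      finally show "(\<integral>\<^sup>+x. f x * g w * indicator A (x / w) \<partial>lborel) = \<dots>" .
    qed
    also have "\<dots> = (\<integral>\<^sup>+t. \<integral>\<^sup>+w. ennreal \<bar>w\<bar> * f (w * t) * g w * indicator A t \<partial>lborel \<partial>lborel)"
      by (rule lborel_pair.Fubini') measurable
    also have "\<dots> = (\<integral>\<^sup>+t. (\<integral>\<^sup>+w. ennreal \<bar>w\<bar> * f (w * t) * g w \<partial>lborel) * indicator A t \<partial>lborel)"
      by (intro nn_integral_cong nn_integral_multc) measurable
    also have "\<dots> = emeasure (density lborel (\<lambda>t. \<integral>\<^sup>+w. ennreal \<bar>w\<bar> * f (w * t) * g w \<partial>lborel)) A"
      by (subst emeasure_density) auto
    finally show "emeasure (distr M lborel (\<lambda>\<omega>. X \<omega> / Y \<omega>)) A = \<dots>" .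
  qed simp
  then show ?thesis by (simp add: distributed_def)
qed

text \<open>Here \<open>a\<close> and \<open>b\<close> are the decay rates of the Bessel factors and
  \<open>x\<close> and \<open>y\<close> the coefficients of \<open>w\<close> in the exponentials.
  They satisfy \<open>\<bar>x\<bar> = \<bar>\<rho>1\<bar> * a\<close> and
  \<open>\<bar>y\<bar> = \<bar>\<rho>2\<bar> * b\<close>, so correlations inside the open interval
  give the strict inequality on which integrability and the series rest.\<close>

lemma ratio_density_normal_product:
  assumes s: "s1 > 0" "s2 > 0" and \<rho>: "\<rho>1 \<in> {-1<..<1}" "\<rho>2 \<in> {-1<..<1}" and t: "t \<noteq> 0"
  defines "q1 \<equiv> 1 - \<rho>1\<^sup>2" and "q2 \<equiv> 1 - \<rho>2\<^sup>2"
  defines "a \<equiv> \<bar>t\<bar> / (s1 * q1)" and "b \<equiv> 1 / (s2 * q2)" and "x \<equiv> \<rho>1 * t / (s1 * q1)" and "y \<equiv> \<rho>2 / (s2 * q2)"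
  defines "C \<equiv> 1 / (pi\<^sup>2 * s1 * s2 * sqrt q1 * sqrt q2)"
  shows "\<bar>w\<bar> * normal_product_density s1 \<rho>1 (w * t) * normal_product_density s2 \<rho>2 w = C * (exp (x * w) * exp (y * w) * K0_weight a b w)"
    and "integrable lborel (\<lambda>w. \<bar>w\<bar> * normal_product_density s1 \<rho>1 (w * t) * normal_product_density s2 \<rho>2 w)"
    and "((\<lambda>(i, j). C * (x ^ i / fact i * (y ^ j / fact j) * (\<integral>w. w ^ (i + j) * K0_weight a b w \<partial>lborel)))
      has_sum ratio_density (normal_product_density s1 \<rho>1) (normal_product_density s2 \<rho>2) t) UNIV"
proof -
  have q: "q1 > 0" "q2 > 0"
    using \<rho> by (simp_all add: q1_def q2_def abs_square_less_1 abs_less_iff)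
  have a: "a > 0" and b: "b > 0"
    using s q t by (simp_all add: a_def b_def)
  have "\<bar>x\<bar> = \<bar>\<rho>1\<bar> * a" "\<bar>y\<bar> = \<bar>\<rho>2\<bar> * b"
    using s q by (simp_all add: x_def y_def a_def b_def abs_mult)
  moreover have "\<bar>\<rho>1\<bar> * a < 1 * a" "\<bar>\<rho>2\<bar> * b < 1 * b"
    using \<rho> a b by (auto intro!: mult_strict_right_mono)
  ultimately have xy: "\<bar>x\<bar> + \<bar>y\<bar> < a + b" by simp
  show eq: "\<bar>w\<bar> * normal_product_density s1 \<rho>1 (w * t) * normal_product_density s2 \<rho>2 w = C * (exp (x * w) * exp (y * w) * K0_weight a b w)" for w
  proof -
    have "\<bar>w * t\<bar> / (s1 * q1) = a * \<bar>w\<bar>" "\<bar>w\<bar> / (s2 * q2) = b * \<bar>w\<bar>"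
      "\<rho>1 * (w * t) / (s1 * q1) = x * w" "\<rho>2 * w / (s2 * q2) = y * w"
      by (simp_all add: a_def b_def x_def y_def abs_mult)
    then show ?thesis
      unfolding normal_product_density_def q1_def[symmetric] q2_def[symmetric] K0_weight_def C_def
      by (simp add: power2_eq_square mult_ac)
  qed
  have [measurable]: "(\<lambda>w. exp (x * w) * exp (y * w) * K0_weight a b w) \<in> borel_measurable borel"
    by measurable
  have int: "integrable lborel (\<lambda>w. exp (x * w) * exp (y * w) * K0_weight a b w)"
  proof (rule Bochner_Integration.integrable_bound[OF integrable_exp_K0_weight[OF a b xy]])
    show "AE w in lborel. norm (exp (x * w) * exp (y * w) * K0_weight a b w) \<le> norm (exp ((\<bar>x\<bar> + \<bar>y\<bar>) * \<bar>w\<bar>) * K0_weight a b w)"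
    proof (intro always_eventually allI)
      fix w
      have "x * w + y * w \<le> (\<bar>x\<bar> + \<bar>y\<bar>) * \<bar>w\<bar>"
        using abs_ge_self[of "x * w"] abs_ge_self[of "y * w"] by (simp add: abs_mult ring_distribs)
      then have "exp (x * w) * exp (y * w) \<le> exp ((\<bar>x\<bar> + \<bar>y\<bar>) * \<bar>w\<bar>)"
        unfolding exp_add[symmetric] by simp
      then show "norm (exp (x * w) * exp (y * w) * K0_weight a b w) \<le> norm (exp ((\<bar>x\<bar> + \<bar>y\<bar>) * \<bar>w\<bar>) * K0_weight a b w)"
        by (simp add: abs_mult mult_right_mono)
    qed
  qed measurable
  then show "integrable lborel (\<lambda>w. \<bar>w\<bar> * normal_product_density s1 \<rho>1 (w * t) * normal_product_density s2 \<rho>2 w)"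
    unfolding eq by (rule integrable_mult_right)
  have "ratio_density (normal_product_density s1 \<rho>1) (normal_product_density s2 \<rho>2) t = C * (\<integral>w. exp (x * w) * exp (y * w) * K0_weight a b w \<partial>lborel)"
    unfolding ratio_density_def eq by simp
  with has_sum_cmult_right[OF has_sum_exp_K0_weight[OF a b xy], of C]
  show "((\<lambda>(i, j). C * (x ^ i / fact i * (y ^ j / fact j) * (\<integral>w. w ^ (i + j) * K0_weight a b w \<partial>lborel)))
      has_sum ratio_density (normal_product_density s1 \<rho>1) (normal_product_density s2 \<rho>2) t) UNIV"
    by (simp add: case_prod_unfold)
qed

lemma borel_measurable_ratio_density [measurable]:
  assumes [measurable]: "f \<in> borel_measurable borel" "g \<in> borel_measurable borel"
  shows "ratio_density f g \<in> borel_measurable borel"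
  unfolding ratio_density_def[abs_def] by measurable

section \<open>Logarithmic closed form for vanishing correlations\<close>

lemma beta_kernel_integral_0:
  assumes a: "a > 0" and b: "b > 0"
  shows "a \<noteq> b \<Longrightarrow> beta_kernel_integral 0 a b = 2 * ln (b / a) / (b\<^sup>2 - a\<^sup>2)"
    and "a = b \<Longrightarrow> beta_kernel_integral 0 a b = 1 / a\<^sup>2"
proof -
  assume "a \<noteq> b"
  then have ne: "b\<^sup>2 - a\<^sup>2 \<noteq> 0" using a b by simp
  have pos: "a\<^sup>2 * (1 - u) + b\<^sup>2 * u > 0" if "u \<in> {0..1}" for u
  proof (cases "u = 1")
    case False
    then show ?thesis
      using that a b by (intro add_pos_nonneg mult_pos_pos mult_nonneg_nonneg) auto
  qed (use b in simp)
  \<comment> \<open>For \<open>m = 0\<close> the integrand is the reciprocal of a linear function of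
    slope \<open>b\<^sup>2 - a\<^sup>2\<close>, which has this logarithmic antiderivative.\<close>
  let ?F = "\<lambda>u. ln (a\<^sup>2 * (1 - u) + b\<^sup>2 * u) / (b\<^sup>2 - a\<^sup>2)"
  have "((\<lambda>u. 1 / (a\<^sup>2 * (1 - u) + b\<^sup>2 * u)) has_integral (?F 1 - ?F 0)) {0..1}"
  proof (rule fundamental_theorem_of_calculus)
    fix u :: real assume "u \<in> {0..1}"
    from pos[OF this] have "(?F has_real_derivative (1 / (a\<^sup>2 * (1 - u) + b\<^sup>2 * u) * (b\<^sup>2 - a\<^sup>2) / (b\<^sup>2 - a\<^sup>2))) (at u within {0..1})"
      by (auto intro!: derivative_eq_intros)
    then show "(?F has_vector_derivative 1 / (a\<^sup>2 * (1 - u) + b\<^sup>2 * u)) (at u within {0..1})"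
      using ne by (simp add: has_real_derivative_iff_has_vector_derivative)
  qed simp
  moreover have "?F 1 - ?F 0 = 2 * ln (b / a) / (b\<^sup>2 - a\<^sup>2)"
    using a b by (simp add: ln_div ln_realpow diff_divide_distrib)
  ultimately show "beta_kernel_integral 0 a b = 2 * ln (b / a) / (b\<^sup>2 - a\<^sup>2)"
    by (simp add: beta_kernel_integral_def integral_unique)
next
  assume "a = b"
  then have "(u * (1 - u)) ^ 0 / (a\<^sup>2 * (1 - u) + b\<^sup>2 * u) ^ (0 + 1) = 1 / a\<^sup>2" for u
    by (simp add: algebra_simps)
  then have "((\<lambda>u::real. 1 / a\<^sup>2) has_integral beta_kernel_integral 0 a b) {0..1}"
    using has_integral_beta_kernel[OF a b, of 0] by (simp only:)
  then show "beta_kernel_integral 0 a b = 1 / a\<^sup>2"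
    using has_integral_const_real[of "1 / a\<^sup>2" 0 1] by (simp add: has_integral_unique)
qed

text \<open>The quotient is the difference quotient of \<open>ln\<close> at 1 times
  \<open>1 / (z + 1)\<close>.\<close>

lemma tendsto_ln_over_square_minus_1: "((\<lambda>z::real. ln z / (z\<^sup>2 - 1)) \<longlongrightarrow> 1 / 2) (at 1)"
proof -
  have "(ln has_real_derivative 1 / 1) (at (1::real))"
    by (rule DERIV_ln_divide) simp
  then have "((\<lambda>z::real. (ln z - ln 1) / (z - 1)) \<longlongrightarrow> 1) (at 1)"
    by (simp add: has_field_derivative_iff)
  then have "((\<lambda>z::real. (ln z - ln 1) / (z - 1) * (1 / (z + 1))) \<longlongrightarrow> 1 * (1 / (1 + 1))) (at 1)"
    by (intro tendsto_intros) auto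
  then show ?thesis
    by (simp add: power2_eq_square algebra_simps)
qed

theorem corollary2p13:
  fixes M :: "'a measure"
    and U1 V1 U2 V2 W1 W2 T :: "'a \<Rightarrow> real"
    and \<sigma>U1 \<sigma>V1 \<sigma>U2 \<sigma>V2 \<rho>1 \<rho>2 s1 s2 :: real
    and fT :: "real \<Rightarrow> real"
  assumes "prob_space M"
    and "\<sigma>U1 > 0" "\<sigma>V1 > 0" "\<sigma>U2 > 0" "\<sigma>V2 > 0"
    and "\<rho>1 \<in> {-1<..<1}" "\<rho>2 \<in> {-1<..<1}"
    and "distributed M lborel (\<lambda>\<omega>. (U1 \<omega>, V1 \<omega>))
           (\<lambda>x. ennreal (bivariate_normal_density 0 0 \<sigma>U1 \<sigma>V1 \<rho>1 x))"
    and "distributed M lborel (\<lambda>\<omega>. (U2 \<omega>, V2 \<omega>))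
           (\<lambda>x. ennreal (bivariate_normal_density 0 0 \<sigma>U2 \<sigma>V2 \<rho>2 x))"
    and "prob_space.indep_var M borel (\<lambda>\<omega>. (U1 \<omega>, V1 \<omega>)) borel (\<lambda>\<omega>. (U2 \<omega>, V2 \<omega>))"
    and "s1 = \<sigma>U1 * \<sigma>V1" "s2 = \<sigma>U2 * \<sigma>V2"
    and "W1 = (\<lambda>\<omega>. U1 \<omega> * V1 \<omega>)" "W2 = (\<lambda>\<omega>. U2 \<omega> * V2 \<omega>)"
    and "T = (\<lambda>\<omega>. W1 \<omega> / W2 \<omega>)"
    and "fT = ratio_density (normal_product_density s1 \<rho>1) (normal_product_density s2 \<rho>2)"
  shows "distributed M lborel T (\<lambda>t. ennreal (fT t))
    \<and> (\<forall>t. t \<noteq> 0 \<longrightarrow>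
         ((\<lambda>(i, j).
             complex_of_real
               (((s1 / s2) * (1 - \<rho>1\<^sup>2) powr (3/2) / t\<^sup>2) / (pi\<^sup>2 * sqrt (1 - \<rho>2\<^sup>2))
                * (even_ind i j * Gamma (real (i + j) / 2 + 1) ^ 4
                   / (fact i * fact j * fact (i + j + 1)))
                * (2 * \<rho>1) ^ i * ((1 - \<rho>1\<^sup>2) / (1 - \<rho>2\<^sup>2)) ^ j * (2 * s1 * \<rho>2 / (s2 * t)) ^ j)
             * hypergeo_2F1 (1 + of_nat (i + j) / 2) (1 + of_nat (i + j) / 2) (2 + of_nat (i + j))
                 (complex_of_real (1 - (s1 * (1 - \<rho>1\<^sup>2) / (s2 * (1 - \<rho>2\<^sup>2) * t))\<^sup>2)))
          has_sum complex_of_real (fT t)) (UNIV :: (nat \<times> nat) set))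
    \<and> (\<rho>1 = 0 \<and> \<rho>2 = 0 \<longrightarrow>
         (\<forall>t. t \<noteq> 0 \<longrightarrow>
            (\<bar>t\<bar> \<noteq> s1 / s2 \<longrightarrow>
               fT t = 2 * s2 / (pi\<^sup>2 * s1) * (ln \<bar>s2 * t / s1\<bar> / ((s2 * t / s1)\<^sup>2 - 1)))
          \<and> (\<bar>t\<bar> = s1 / s2 \<longrightarrow>
               ((\<lambda>x. 2 * s2 / (pi\<^sup>2 * s1) * (ln \<bar>s2 * x / s1\<bar> / ((s2 * x / s1)\<^sup>2 - 1)))
                \<longlongrightarrow> fT t) (at t))))"
proof (intro conjI allI impI)
  interpret prob_space M by fact
  note fT = \<open>fT = ratio_density (normal_product_density s1 \<rho>1) (normal_product_density s2 \<rho>2)\<close>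
  note \<rho> = \<open>\<rho>1 \<in> {-1<..<1}\<close> \<open>\<rho>2 \<in> {-1<..<1}\<close>
  have s: "s1 > 0" "s2 > 0"
    using assms by simp_all
  define q1 where "q1 = 1 - \<rho>1\<^sup>2"
  define q2 where "q2 = 1 - \<rho>2\<^sup>2"
  define C where "C = 1 / (pi\<^sup>2 * s1 * s2 * sqrt q1 * sqrt q2)"
  have q: "q1 > 0" "q2 > 0"
    using \<rho> by (simp_all add: q1_def q2_def abs_square_less_1 abs_less_iff)
  note ratio = ratio_density_normal_product[OF s \<rho>, folded q1_def q2_def, folded C_def]

  show "distributed M lborel T (\<lambda>t. ennreal (fT t))"
  proof -
    have W1: "distributed M lborel W1 (\<lambda>w. ennreal (normal_product_density s1 \<rho>1 w))"
      and W2: "distributed M lborel W2 (\<lambda>w. ennreal (normal_product_density s2 \<rho>2 w))"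
      using assms by (auto intro: distributed_product_bivariate_normal)
    have "(\<lambda>(u, v). u * v) \<in> borel_measurable (borel :: (real \<times> real) measure)"
      by (simp add: borel_prod[symmetric])
    then have "indep_var borel W1 borel W2"
      using indep_var_compose[of borel "\<lambda>\<omega>. (U1 \<omega>, V1 \<omega>)" borel "\<lambda>\<omega>. (U2 \<omega>, V2 \<omega>)" "\<lambda>(u, v). u * v" borel "\<lambda>(u, v). u * v" borel] assms
      by (simp add: comp_def)
    from distributed_ratio_indep[OF W1 W2 this]
    have D: "distributed M lborel T (\<lambda>t. \<integral>\<^sup>+w. ennreal \<bar>w\<bar> * ennreal (normal_product_density s1 \<rho>1 (w * t)) * ennreal (normal_product_density s2 \<rho>2 w) \<partial>lborel)"
      using assms by simp
    \<comment> \<open>Integrability is available for \<open>t \<noteq> 0\<close>; the remaining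
      point is a null set and does not affect the density.\<close>
    have eq: "(\<integral>\<^sup>+w. ennreal \<bar>w\<bar> * ennreal (normal_product_density s1 \<rho>1 (w * t)) * ennreal (normal_product_density s2 \<rho>2 w) \<partial>lborel) = ennreal (fT t)"
      if "t \<noteq> 0" for t
    proof -
      have nonneg: "0 \<le> normal_product_density s1 \<rho>1 w" "0 \<le> normal_product_density s2 \<rho>2 w" for w
        using s \<rho> by (auto intro: normal_product_density_nonneg)
      then have "(\<integral>\<^sup>+w. ennreal \<bar>w\<bar> * ennreal (normal_product_density s1 \<rho>1 (w * t)) * ennreal (normal_product_density s2 \<rho>2 w) \<partial>lborel)
         = (\<integral>\<^sup>+w. ennreal (\<bar>w\<bar> * normal_product_density s1 \<rho>1 (w * t) * normal_product_density s2 \<rho>2 w) \<partial>lborel)"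
        by (simp add: ennreal_mult)
      also have "\<dots> = ennreal (fT t)"
        unfolding fT ratio_density_def
        using nonneg by (intro nn_integral_eq_integral ratio(2) that) auto
      finally show ?thesis .
    qed
    show ?thesis
    proof (rule distributed_cong_density[THEN iffD1, OF _ _ _ D])
      show "AE t in lborel. (\<integral>\<^sup>+w. ennreal \<bar>w\<bar> * ennreal (normal_product_density s1 \<rho>1 (w * t)) * ennreal (normal_product_density s2 \<rho>2 w) \<partial>lborel) = ennreal (fT t)"
        by (rule AE_mp[OF AE_lborel_singleton[of 0]]) (auto simp: eq)
      show "(\<lambda>t. ennreal (fT t)) \<in> borel_measurable lborel"
        unfolding fT by simp
    qed (use distributed_borel_measurable[OF D] in simp)
  qed

  fix t :: real assume t: "t \<noteq> 0"
  define a where "a = \<bar>t\<bar> / (s1 * q1)"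
  define b where "b = 1 / (s2 * q2)"
  have a: "a > 0" and b: "b > 0"
    using s q t by (simp_all add: a_def b_def)
  define x where "x = \<rho>1 * t / (s1 * q1)"
  define y where "y = \<rho>2 / (s2 * q2)"
  have sum: "((\<lambda>(i, j). C * (x ^ i / fact i * (y ^ j / fact j) * (\<integral>w. w ^ (i + j) * K0_weight a b w \<partial>lborel))) has_sum fT t) UNIV"
    using ratio(3)[OF t] unfolding fT a_def b_def x_def y_def .
  \<comment> \<open>The sign of \<open>t\<close> disappears in the square, so the stated argument is
    a function of the ratio of the two decay rates.\<close>
  have ba: "(s1 * q1 / (s2 * q2 * t))\<^sup>2 = (b / a)\<^sup>2"
    using s q t by (simp add: a_def b_def power_divide power_mult_distrib)
  \<comment> \<open>An even power ignores the modulus in \<open>a\<close>, so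
    \<open>a ^ (2 * m + 2)\<close> splits into \<open>?d ^ i\<close>, \<open>?d ^ j\<close> and
    \<open>?d\<^sup>2\<close>. The first two turn the stated powers into those of
    \<open>2 * x\<close> and \<open>2 * y\<close>, the last turns the prefactor into
    \<open>C\<close>, and \<open>2 ^ (i + j)\<close> is the \<open>4 ^ m\<close> of the
    moment.\<close>
  have coeff: "s1 / s2 * q1 powr (3/2) / t\<^sup>2 / (pi\<^sup>2 * sqrt q2) * (2 * \<rho>1) ^ i * (q1 / q2) ^ j * (2 * s1 * \<rho>2 / (s2 * t)) ^ j * a ^ (2 * m + 2)
     = C * (4 ^ m * x ^ i * y ^ j)" if "i + j = 2 * m" for i j m
  proof -
    let ?d = "t / (s1 * q1)"
    have "a = \<bar>?d\<bar>"
      using s q by (simp add: a_def abs_mult)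
    then have "a ^ (2 * m + 2) = ?d ^ (2 * m + 2)"
      by (simp only:) (rule power_even_abs, simp)
    also have "\<dots> = ?d ^ i * ?d ^ j * ?d\<^sup>2"
      by (simp only: that[symmetric] power_add)
    finally have "s1 / s2 * q1 powr (3/2) / t\<^sup>2 / (pi\<^sup>2 * sqrt q2) * (2 * \<rho>1) ^ i * (q1 / q2) ^ j * (2 * s1 * \<rho>2 / (s2 * t)) ^ j * a ^ (2 * m + 2)
      = (s1 / s2 * q1 powr (3/2) / t\<^sup>2 / (pi\<^sup>2 * sqrt q2) * ?d\<^sup>2) * (2 * \<rho>1 * ?d) ^ i * (q1 / q2 * (2 * s1 * \<rho>2 / (s2 * t)) * ?d) ^ j"
      by (simp only: power_mult_distrib mult_ac)
    also have "2 * \<rho>1 * ?d = 2 * x" by (simp add: x_def)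
    also have "q1 / q2 * (2 * s1 * \<rho>2 / (s2 * t)) * ?d = 2 * y"
      using s q t by (simp add: y_def)
    also have "s1 / s2 * q1 powr (3/2) / t\<^sup>2 / (pi\<^sup>2 * sqrt q2) * ?d\<^sup>2 = C"
    proof -
      have "q1 powr (3/2) = q1 powr (1 + 1/2)" by simp
      also have "\<dots> = q1 * sqrt q1"
        unfolding powr_add using q by (simp add: powr_half_sqrt)
      finally have "q1 powr (3/2) = q1 * sqrt q1" .
      then have "s1 / s2 * q1 powr (3/2) / t\<^sup>2 / (pi\<^sup>2 * sqrt q2) * ?d\<^sup>2 = sqrt q1 / q1 / (pi\<^sup>2 * s1 * s2 * sqrt q2)"
        using s q t by (simp add: power_divide power_mult_distrib power2_eq_square)
      moreover have "sqrt q1 / q1 = 1 / sqrt q1"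
        using q by (simp add: field_simps)
      ultimately show ?thesis
        by (simp add: C_def mult_ac)
    qed
    also have "C * (2 * x) ^ i * (2 * y) ^ j = C * (2 ^ (i + j) * x ^ i * y ^ j)"
      by (simp add: power_mult_distrib power_add)
    also have "(2::real) ^ (i + j) = 4 ^ m"
      unfolding that by (simp add: power_mult)
    finally show ?thesis .
  qed
  show "((\<lambda>(i, j).
             complex_of_real
               (((s1 / s2) * (1 - \<rho>1\<^sup>2) powr (3/2) / t\<^sup>2) / (pi\<^sup>2 * sqrt (1 - \<rho>2\<^sup>2))
                * (even_ind i j * Gamma (real (i + j) / 2 + 1) ^ 4
                   / (fact i * fact j * fact (i + j + 1)))
                * (2 * \<rho>1) ^ i * ((1 - \<rho>1\<^sup>2) / (1 - \<rho>2\<^sup>2)) ^ j * (2 * s1 * \<rho>2 / (s2 * t)) ^ j)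
             * hypergeo_2F1 (1 + of_nat (i + j) / 2) (1 + of_nat (i + j) / 2) (2 + of_nat (i + j))
                 (complex_of_real (1 - (s1 * (1 - \<rho>1\<^sup>2) / (s2 * (1 - \<rho>2\<^sup>2) * t))\<^sup>2)))
          has_sum complex_of_real (fT t)) (UNIV :: (nat \<times> nat) set)"
    unfolding q1_def[symmetric] q2_def[symmetric] ba
  proof (rule has_sum_cong[THEN iffD1, OF _ has_sum_of_real[OF sum]], clarify)
    fix i j :: nat
    show "complex_of_real (C * (x ^ i / fact i * (y ^ j / fact j) * (\<integral>w. w ^ (i + j) * K0_weight a b w \<partial>lborel)))
      = complex_of_real (s1 / s2 * q1 powr (3/2) / t\<^sup>2 / (pi\<^sup>2 * sqrt q2)
                * (even_ind i j * Gamma (real (i + j) / 2 + 1) ^ 4 / (fact i * fact j * fact (i + j + 1)))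
                * (2 * \<rho>1) ^ i * (q1 / q2) ^ j * (2 * s1 * \<rho>2 / (s2 * t)) ^ j)
             * hypergeo_2F1 (1 + of_nat (i + j) / 2) (1 + of_nat (i + j) / 2) (2 + of_nat (i + j)) (complex_of_real (1 - (b / a)\<^sup>2))"
    proof (cases "even (i + j)")
      case True
      then obtain m where m: "i + j = 2 * m" by (elim evenE)
      have "Gamma (real (i + j) / 2 + 1) = fact m"
        unfolding m using Gamma_fact[of m, where 'a = real] by (simp add: add.commute)
      moreover have "even_ind i j = 1"
        using True by (simp add: even_ind_def)
      moreover have "1 + of_nat (i + j) / 2 = (of_nat (m + 1) :: complex)" "2 + of_nat (i + j) = (of_nat (2 * m + 2) :: complex)"
        unfolding m by simp_all
      \<comment> \<open>Of the fourth power of \<open>fact m\<close> two factors cancel against the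
        normalising constant of the Euler integral, as does \<open>fact (2 * m + 1)\<close>; the
        other two are those of the moment.\<close>
      moreover have "C * (x ^ i / fact i * (y ^ j / fact j) * (4 ^ m * (fact m)\<^sup>2 * beta_kernel_integral m a b))
        = s1 / s2 * q1 powr (3/2) / t\<^sup>2 / (pi\<^sup>2 * sqrt q2)
                * (1 * fact m ^ 4 / (fact i * fact j * fact (2 * m + 1)))
                * (2 * \<rho>1) ^ i * (q1 / q2) ^ j * (2 * s1 * \<rho>2 / (s2 * t)) ^ j
             * (fact (2 * m + 1) / (fact m)\<^sup>2 * (a ^ (2 * m + 2) * beta_kernel_integral m a b))"
      proof -
        have rearrange: "P * (1 * f ^ 4 / (fi * fj * F)) * r * k * l * (F / f\<^sup>2 * (A * B)) = P * r * k * l * A * (f\<^sup>2 / (fi * fj) * B)"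
          if "f \<noteq> 0" "F \<noteq> 0" for P f fi fj F r k l A B :: real
          using that by (simp add: power2_eq_square power4_eq_xxxx)
        show ?thesis
          unfolding rearrange[OF fact_nonzero fact_nonzero] coeff[OF m] by simp
      qed
      ultimately show ?thesis
        by (simp only: m K0_weight_moment_even[OF a b] hypergeo_2F1_eq_beta_kernel_integral[OF a b] of_real_mult[symmetric])
    next
      case False
      then show ?thesis
        by (simp add: K0_weight_moment_odd even_ind_def)
    qed
  qed

  assume "\<rho>1 = 0 \<and> \<rho>2 = 0"
  then have zero: "q1 = 1" "q2 = 1" "x = 0" "y = 0"
    by (simp_all add: q1_def q2_def x_def y_def)
  \<comment> \<open>With \<open>x = y = 0\<close> both exponentials are 1, so the value is read off
    from the integral itself as a moment of order 0.\<close>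
  have fT_eq: "fT t = 1 / (pi\<^sup>2 * s1 * s2) * beta_kernel_integral 0 a b"
  proof -
    have "fT t = C * (\<integral>w. w ^ (2 * 0) * K0_weight a b w \<partial>lborel)"
      unfolding fT ratio_density_def ratio(1)[OF t] a_def[symmetric] b_def[symmetric] x_def[symmetric] y_def[symmetric]
      by (simp add: zero)
    then show ?thesis
      unfolding K0_weight_moment_even[OF a b] by (simp add: C_def zero)
  qed
  have ab: "a = \<bar>t\<bar> / s1" "b = 1 / s2" by (simp_all add: a_def b_def zero)
  have ab_iff: "a = b \<longleftrightarrow> \<bar>t\<bar> = s1 / s2"
    using s by (auto simp: ab field_simps)
  show "fT t = 2 * s2 / (pi\<^sup>2 * s1) * (ln \<bar>s2 * t / s1\<bar> / ((s2 * t / s1)\<^sup>2 - 1))" if "\<bar>t\<bar> \<noteq> s1 / s2"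
  proof -
    define z where "z = \<bar>s2 * t / s1\<bar>"
    have sq: "(s2 * t / s1)\<^sup>2 = z\<^sup>2"
      by (simp only: z_def power2_abs)
    have z: "z > 0" "a = z * b"
      using s t by (simp_all add: z_def ab abs_mult)
    \<comment> \<open>Here \<open>z\<close> is \<open>a / b\<close>; passing to the reciprocal
      changes the sign of the logarithm, and the denominator \<open>b\<^sup>2 - a\<^sup>2\<close>
      changes sign with it.\<close>
    have "b / a = inverse z" using z b by (simp add: field_simps)
    then have "beta_kernel_integral 0 a b = 2 * (- ln z) / (b\<^sup>2 - a\<^sup>2)"
      using beta_kernel_integral_0(1)[OF a b] that ab_iff z(1) by (simp add: ln_inverse)
    also have "b\<^sup>2 - a\<^sup>2 = - (b\<^sup>2 * (z\<^sup>2 - 1))"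
      by (simp add: z(2) power_mult_distrib algebra_simps)
    also have "2 * (- ln z) / \<dots> = 2 * s2\<^sup>2 * (ln z / (z\<^sup>2 - 1))"
      using s by (simp add: ab power_divide)
    finally show ?thesis
      unfolding fT_eq sq z_def[symmetric] using s by (simp add: power2_eq_square)
  qed
  show "((\<lambda>x. 2 * s2 / (pi\<^sup>2 * s1) * (ln \<bar>s2 * x / s1\<bar> / ((s2 * x / s1)\<^sup>2 - 1))) \<longlongrightarrow> fT t) (at t)" if "\<bar>t\<bar> = s1 / s2"
  proof -
    have fT_t: "fT t = 2 * s2 / (pi\<^sup>2 * s1) * (1 / 2)"
      using beta_kernel_integral_0(2)[OF a b] that ab_iff s
      unfolding fT_eq by (simp add: ab power_divide power2_eq_square)
    have "filterlim (\<lambda>x. \<bar>s2 * x / s1\<bar>) (at 1) (at t)"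
    proof (rule filterlim_atI)
      have "((\<lambda>x. \<bar>s2 * x / s1\<bar>) \<longlongrightarrow> \<bar>s2 * t / s1\<bar>) (at t)"
        using s by (intro tendsto_intros) auto
      moreover have "\<bar>s2 * t / s1\<bar> = 1"
        using s that by (simp add: abs_mult)
      ultimately show "((\<lambda>x. \<bar>s2 * x / s1\<bar>) \<longlongrightarrow> 1) (at t)" by (simp only:)
      \<comment> \<open>The modulus equals 1 only at \<open>t\<close> and \<open>- t\<close>. The
        first is excluded by the punctured filter, the second is bounded away from \<open>t\<close>
        because \<open>t \<noteq> 0\<close>.\<close>
      have "\<forall>\<^sub>F x in at t. x \<noteq> - t"
        using t by (intro tendsto_imp_eventually_ne[OF tendsto_ident_at]) auto
      moreover have "\<forall>\<^sub>F x in at t. x \<noteq> t"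
        by (simp add: eventually_at_filter)
      ultimately show "\<forall>\<^sub>F x in at t. \<bar>s2 * x / s1\<bar> \<noteq> 1"
      proof eventually_elim
        case (elim x)
        then have "\<bar>x\<bar> \<noteq> \<bar>t\<bar>" by (auto simp: abs_eq_iff)
        then show ?case using s that by (simp add: abs_mult field_simps)
      qed
    qed
    from filterlim_compose[OF tendsto_ln_over_square_minus_1 this]
    have "((\<lambda>x. ln \<bar>s2 * x / s1\<bar> / ((s2 * x / s1)\<^sup>2 - 1)) \<longlongrightarrow> 1 / 2) (at t)"
      by (simp only: power2_abs)
    then show ?thesis
      unfolding fT_t by (rule tendsto_mult_left)
  qed
qed

end
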